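(* For each $n$, let $C$ be uniformly distributed on $\mathcal{E}_n$. Let $B_1,\ldots,B_m\subseteq\mathbb{R}$ be disjoint Borel sets bounded away from $-\infty$, with $\Lambda(B_r)<\infty$ and $\Lambda(\partial B_r)=0$ for each $r$. Then, as $n\to\infty$, $$ d_{\mathrm{TV}}\Bigl(\mathcal{L}\bigl(\Xi_n(B_1),\ldots,\Xi_n(B_m)\bigr),\ \bigotimes_{r=1}^m\operatorname{Poisson}\bigl(d\,p_n(B_r)\bigr)\Bigr)=O(n^{-1}), $$ where $d=n(n-1)/2$ and $p_n(B_r)=\Pr\{(n+1)C_{12}^2-\mu_n\in B_r\}$, so that $d\,p_n(B_r)=\mathbb{E}[\Xi_n(B_r)]$ is the exact finite-$n$ mean (the implied constant may depend on $B_1,\dots,B_m$ but not on $n$).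
   Context: $\mathcal{E}_n=\{C\in\mathbb{R}^{n\times n}: C=C',\ C\succeq 0,\ C_{ii}=1 \text{ for all } i\}$ is the set of $n\times n$ correlation matrices; the uniform distribution on it is normalized $d$-dimensional Lebesgue measure, $d=n(n-1)/2$, in the off-diagonal coordinates $(C_{ij})_{i<j}$. Let $\mu_n=\log\frac{n^4}{\log n}$, let $\Lambda$ be the measure on $\mathbb{R}$ with density $\frac{1}{2\sqrt{8\pi}}e^{-t/2}$, and for Borel $B\subseteq\mathbb{R}$ let $$\Xi_n(B)=\#\{(i,j): 1\le i<j\le n,\ (n+1)C_{ij}^2-\mu_n\in B\}.$$ A set $B$ is bounded away from $-\infty$ if $\inf B>-\infty$. $\mathcal{L}(X)$ denotes the law of $X$, and $d_{\mathrm{TV}}(P,Q)=\sup_A|P(A)-Q(A)|$. *)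

theory Defs
  imports "HOL-Probability.Probability" "HOL-Library.Landau_Symbols"
    "Jordan_Normal_Form.Matrix"
begin

(* Matrix and vector indices run from 0 to n - 1. *)

definition pos_semidef :: "nat \<Rightarrow> real mat \<Rightarrow> bool" where
  "pos_semidef n C \<longleftrightarrow> (\<forall>v \<in> carrier_vec n. 0 \<le> scalar_prod v (mult_mat_vec C v))"

definition correlation_matrices :: "nat \<Rightarrow> real mat set" where
  "correlation_matrices n =
     {C \<in> carrier_mat n n. transpose_mat C = C \<and> pos_semidef n C \<and> (\<forall>i<n. C $$ (i, i) = 1)}"

definition pairs :: "nat \<Rightarrow> (nat \<times> nat) set" where
  "pairs n = {(i, j). i < j \<and> j < n}"

definition offdiag :: "nat \<Rightarrow> real mat \<Rightarrow> nat \<times> nat \<Rightarrow> real" where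
  "offdiag n C = (\<lambda>p \<in> pairs n. C $$ p)"

definition offdiag_lebesgue :: "nat \<Rightarrow> (nat \<times> nat \<Rightarrow> real) measure" where
  "offdiag_lebesgue n = PiM (pairs n) (\<lambda>_. lborel)"

(* A correlation matrix is determined by its above-diagonal entries, so the law of C is
   prescribed through these coordinates. *)
definition uniform_correlation :: "'a measure \<Rightarrow> nat \<Rightarrow> ('a \<Rightarrow> real mat) \<Rightarrow> bool" where
  "uniform_correlation M n C \<longleftrightarrow>
     prob_space M \<and>
     (\<forall>\<omega> \<in> space M. C \<omega> \<in> correlation_matrices n) \<and>
     (\<lambda>\<omega>. offdiag n (C \<omega>)) \<in> measurable M (offdiag_lebesgue n) \<and>
     distr M (offdiag_lebesgue n) (\<lambda>\<omega>. offdiag n (C \<omega>)) =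
       uniform_measure (offdiag_lebesgue n) (offdiag n ` correlation_matrices n)"

definition mu :: "nat \<Rightarrow> real" where
  "mu n = ln (real n ^ 4 / ln (real n))"

definition Lambda :: "real measure" where
  "Lambda = density lborel (\<lambda>t. ennreal (1 / (2 * sqrt (8 * pi)) * exp (- t / 2)))"

definition Xi :: "nat \<Rightarrow> real mat \<Rightarrow> real set \<Rightarrow> nat" where
  "Xi n C B = card {(i, j) \<in> pairs n. (real n + 1) * (C $$ (i, j))\<^sup>2 - mu n \<in> B}"

definition pair_prob :: "'a measure \<Rightarrow> nat \<Rightarrow> ('a \<Rightarrow> real mat) \<Rightarrow> real set \<Rightarrow> real" where
  "pair_prob M n C B = measure M {\<omega> \<in> space M. (real n + 1) * (C \<omega> $$ (0, 1))\<^sup>2 - mu n \<in> B}"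

definition num_pairs :: "nat \<Rightarrow> real" where
  "num_pairs n = real n * (real n - 1) / 2"

(* The library's poisson_pmf is only specified for positive rates, while the mean of Xi can be 0. *)
definition Poisson :: "real \<Rightarrow> nat pmf" where
  "Poisson r = (if r = 0 then return_pmf 0 else poisson_pmf r)"

(* For probability measures P and Q on the same sigma-algebra. *)
definition tv_dist :: "'b measure \<Rightarrow> 'b measure \<Rightarrow> real" where
  "tv_dist P Q = (SUP A \<in> sets P. \<bar>measure P A - measure Q A\<bar>)"

definition Xi_law ::
  "'a measure \<Rightarrow> nat \<Rightarrow> ('a \<Rightarrow> real mat) \<Rightarrow> nat \<Rightarrow> (nat \<Rightarrow> real set) \<Rightarrow> (nat \<Rightarrow> nat) measure" where
  "Xi_law M n C m B =
     distr M (PiM {1..m} (\<lambda>_. count_space UNIV)) (\<lambda>\<omega>. \<lambda>r \<in> {1..m}. Xi n (C \<omega>) (B r))"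

definition Poisson_product :: "nat \<Rightarrow> (nat \<Rightarrow> real) \<Rightarrow> (nat \<Rightarrow> nat) measure" where
  "Poisson_product m rate = PiM {1..m} (\<lambda>r. measure_pmf (Poisson (rate r)))"

end

(* Fix i \<noteq> k and put a = C_ik. The substitution C_iq = a C_kq + sqrt(1 - a^2) z_q for q \<noteq> i, k
   turns C into the matrix with C_ik replaced by 0 and C_iq by z_q, conjugated by an invertible
   matrix, so it preserves positive semidefiniteness and contributes the Jacobian
   (1 - a^2)^((n-2)/2). Integrating out the z_q, the joint density of C_ik and of the submatrix
   without row i is (1 - a^2)^((n-2)/2) times a function of the submatrix. Hence C_ik is independent
   of that submatrix, any two entries are independent, and a Gaussian tail estimate shows that an
   entry hits a set bounded from below with probability O(n^-2).

   The counts are then compared with Poisson variables by the Chen-Stein method, with the pairs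
   containing the larger index of \<alpha> as dependency neighbourhood of \<alpha>. The coordinates
   are replaced by Poisson variables one at a time, the others entering the one-dimensional Stein
   equation as parameters. As the rates stay bounded, the crude bound exp(rate) on the Stein
   solution suffices; no estimate of its differences is needed. *)
theory Submission
  imports Defs "HOL-Real_Asymp.Real_Asymp"
begin

section \<open>Positive semidefiniteness in the off-diagonal coordinates\<close>

text \<open>Entries are pairwise but not mutually independent: positivity of a 3 by 3 block ties the
  three entries of a triangle together. Deleting row i, or deleting row k, frees C_ik from what is
  left, but not from all other entries at once. A neighbourhood therefore takes in the whole row of
  one endpoint. The other endpoint is kept for the joint probabilities: a neighbour of \<alpha>
  different from \<alpha> avoids it, so deleting that row makes them factor too.

  This fixes the order of the error: about n^2 choices of \<alpha>, at most n neighbours each, and a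
  product of two probabilities of order n^(-2) give n^2 * n * n^(-4) = n^(-1). Stein values are
  compared only when some neighbour is marked, an event whose probability already pays for the
  error; this is why boundedness is enough.

  The volume of the set of correlation matrices is never evaluated: the unknown function of the
  submatrix cancels in the normalisation, and only the one-dimensional weight is estimated, from
  below near 0 and from above in its tail.\<close>

definition edge :: "nat \<Rightarrow> nat \<Rightarrow> nat \<times> nat" where
  "edge i j = (min i j, max i j)"

definition sym_entry :: "(nat \<times> nat \<Rightarrow> real) \<Rightarrow> nat \<Rightarrow> nat \<Rightarrow> real" where
  "sym_entry x i j = (if i = j then 1 else x (edge i j))"

definition quad_form :: "nat \<Rightarrow> (nat \<times> nat \<Rightarrow> real) \<Rightarrow> (nat \<Rightarrow> real) \<Rightarrow> real" where
  "quad_form n x v = (\<Sum>p<n. \<Sum>q<n. v p * v q * sym_entry x p q)"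

text \<open>Test vectors are arbitrary functions on the naturals, of which only the values below n
  enter; this spares a carrier set. Extensionality places the points in the product space of
  \<open>offdiag_lebesgue\<close>.\<close>

definition elliptope :: "nat \<Rightarrow> (nat \<times> nat \<Rightarrow> real) set" where
  "elliptope n = {x \<in> extensional (pairs n). \<forall>v. 0 \<le> quad_form n x v}"

lemma edge_commute: "edge i j = edge j i"
  by (simp add: edge_def min.commute max.commute)

lemma edge_eq_iff: "edge i j = edge p q \<longleftrightarrow> i = p \<and> j = q \<or> i = q \<and> j = p"
  by (auto simp: edge_def min_def max_def split: if_splits)

lemma edge_of_less: "i < j \<Longrightarrow> edge i j = (i, j)"
  by (simp add: edge_def)

lemma edge_in_pairs_iff: "edge i j \<in> pairs n \<longleftrightarrow> i \<noteq> j \<and> i < n \<and> j < n"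
  by (auto simp: edge_def pairs_def min_def max_def)

lemma sym_entry_commute: "sym_entry x i j = sym_entry x j i"
  by (simp add: sym_entry_def edge_commute)

lemma finite_pairs: "finite (pairs n)"
  by (rule finite_subset[of _ "{..<n} \<times> {..<n}"]) (auto simp: pairs_def)

section \<open>Congruence that clears one off-diagonal entry\<close>

lemma quadratic_form_split_two:
  fixes c :: "nat \<Rightarrow> nat \<Rightarrow> real"
  assumes c: "\<And>p q. c p q = c q p" and ik: "i < n" "k < n" "i \<noteq> k"
  defines "R \<equiv> {..<n} - {i, k}"
  shows "(\<Sum>p<n. \<Sum>q<n. v p * v q * c p q) =
    (v i)\<^sup>2 * c i i + (v k)\<^sup>2 * c k k + 2 * v i * v k * c i k
    + 2 * v i * (\<Sum>q\<in>R. v q * c i q) + 2 * v k * (\<Sum>q\<in>R. v q * c k q)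
    + (\<Sum>p\<in>R. \<Sum>q\<in>R. v p * v q * c p q)"
proof -
  have split: "(\<Sum>p<n. f p) = f i + f k + (\<Sum>p\<in>R. f p)" for f :: "nat \<Rightarrow> real"
  proof -
    have "(\<Sum>p<n. f p) = f i + (\<Sum>p\<in>{..<n} - {i}. f p)"
      using ik by (intro sum.remove) auto
    also have "(\<Sum>p\<in>{..<n} - {i}. f p) = f k + (\<Sum>p\<in>{..<n} - {i} - {k}. f p)"
      using ik by (intro sum.remove) auto
    also have "{..<n} - {i} - {k} = R" by (auto simp: R_def)
    finally show ?thesis by simp
  qed
  have "(\<Sum>p\<in>R. v p * (v j * c p j)) = v j * (\<Sum>q\<in>R. v q * c j q)" for j
    unfolding sum_distrib_left by (intro sum.cong refl) (simp add: c[of _ j])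
  moreover have "(\<Sum>p\<in>R. v j * (v p * c j p)) = v j * (\<Sum>q\<in>R. v q * c j q)" for j
    by (simp add: sum_distrib_left algebra_simps)
  ultimately show ?thesis
    by (simp add: split sum.distrib c[of k i] power2_eq_square distrib_left distrib_right mult.assoc)
qed

text \<open>A congruence written in terms of test vectors: row i of x combines rows i and k of y
  with coefficients s and a. Since y has entry 0 at (i, k), the new diagonal entry at i is s^2 +
  a^2, so the unit diagonal survives by \<open>s\<close>, and the new entry at (i, k) is a.\<close>

lemma quad_form_pivot:
  assumes ik: "i < n" "k < n" "i \<noteq> k" and s: "s\<^sup>2 + a\<^sup>2 = 1"
    and x: "sym_entry x i k = a" "sym_entry y i k = 0"
    and row: "\<And>q. q < n \<Longrightarrow> q \<noteq> i \<Longrightarrow> q \<noteq> k \<Longrightarrow>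
        sym_entry x i q = a * sym_entry y k q + s * sym_entry y i q"
    and rest: "\<And>p q. p < n \<Longrightarrow> q < n \<Longrightarrow> p \<noteq> i \<Longrightarrow> q \<noteq> i \<Longrightarrow> sym_entry x p q = sym_entry y p q"
  shows "quad_form n x v = quad_form n y (v(i := s * v i, k := v k + a * v i))"
proof -
  let ?R = "{..<n} - {i, k}"
  let ?w = "v(i := s * v i, k := v k + a * v i)"
  have split: "quad_form n z u = (u i)\<^sup>2 + (u k)\<^sup>2 + 2 * u i * u k * sym_entry z i k
    + 2 * u i * (\<Sum>q\<in>?R. u q * sym_entry z i q) + 2 * u k * (\<Sum>q\<in>?R. u q * sym_entry z k q)
    + (\<Sum>p\<in>?R. \<Sum>q\<in>?R. u p * u q * sym_entry z p q)" for z u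
    unfolding quad_form_def
    using quadratic_form_split_two[of "sym_entry z" i n k u, OF sym_entry_commute ik]
    by (simp add: sym_entry_def[of z i i] sym_entry_def[of z k k])
  have 1: "(\<Sum>q\<in>?R. v q * sym_entry x i q)
      = a * (\<Sum>q\<in>?R. v q * sym_entry y k q) + s * (\<Sum>q\<in>?R. v q * sym_entry y i q)"
    unfolding sum_distrib_left sum.distrib[symmetric]
    by (intro sum.cong refl) (auto simp: row algebra_simps)
  have 2: "(\<Sum>q\<in>?R. v q * sym_entry x k q) = (\<Sum>q\<in>?R. v q * sym_entry y k q)"
    using ik by (intro sum.cong refl) (auto simp: rest)
  have 3: "(\<Sum>p\<in>?R. \<Sum>q\<in>?R. v p * v q * sym_entry x p q)
     = (\<Sum>p\<in>?R. \<Sum>q\<in>?R. v p * v q * sym_entry y p q)"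
    by (intro sum.cong refl) (auto simp: rest)
  have 4: "(\<Sum>q\<in>?R. ?w q * sym_entry y j q) = (\<Sum>q\<in>?R. v q * sym_entry y j q)" for j
    by (intro sum.cong refl) auto
  have 5: "(\<Sum>p\<in>?R. \<Sum>q\<in>?R. ?w p * ?w q * sym_entry y p q)
     = (\<Sum>p\<in>?R. \<Sum>q\<in>?R. v p * v q * sym_entry y p q)"
    by (intro sum.cong refl) auto
  have "(v i)\<^sup>2 = (s * v i)\<^sup>2 + a\<^sup>2 * (v i)\<^sup>2"
    using s by (metis distrib_right mult_1 power_mult_distrib)
  then show ?thesis
    using ik unfolding split[of x v] split[of y ?w] 1 2 3 4 5 x
    by (simp add: algebra_simps power2_eq_square)
qed

text \<open>As s is nonzero, the linear change of test vectors is invertible, so both forms take the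
  same values.\<close>

lemma quad_form_nonneg_pivot_iff:
  assumes ik: "i < n" "k < n" "i \<noteq> k" and s: "s\<^sup>2 + a\<^sup>2 = 1" "s \<noteq> 0"
    and x: "sym_entry x i k = a" "sym_entry y i k = 0"
    and row: "\<And>q. q < n \<Longrightarrow> q \<noteq> i \<Longrightarrow> q \<noteq> k \<Longrightarrow>
        sym_entry x i q = a * sym_entry y k q + s * sym_entry y i q"
    and rest: "\<And>p q. p < n \<Longrightarrow> q < n \<Longrightarrow> p \<noteq> i \<Longrightarrow> q \<noteq> i \<Longrightarrow> sym_entry x p q = sym_entry y p q"
  shows "(\<forall>v. 0 \<le> quad_form n x v) \<longleftrightarrow> (\<forall>v. 0 \<le> quad_form n y v)"
proof -
  have pivot: "quad_form n x v = quad_form n y (v(i := s * v i, k := v k + a * v i))" for v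
    by (rule quad_form_pivot[OF ik s(1) x row rest])
  have "quad_form n y w = quad_form n x (w(i := w i / s, k := w k - a * (w i / s)))" for w
    using ik(3) s(2) by (subst pivot) (auto simp: fun_upd_idem_iff fun_upd_twist intro!: arg_cong[where f = "quad_form n y"])
  then show ?thesis using pivot by metis
qed

text \<open>Tested on the vectors with entry 1 at i and 1 or -1 at k. The bound empties the fibres
  over values of modulus above 1, which accounts for the zero branch of
  \<open>entry_weight\<close>.\<close>

lemma quad_form_nonneg_imp_abs_entry_le_1:
  assumes ik: "i < n" "k < n" "i \<noteq> k" and x: "\<And>v. 0 \<le> quad_form n x v"
  shows "\<bar>sym_entry x i k\<bar> \<le> 1"
proof -
  have "quad_form n x ((\<lambda>_. 0)(i := 1, k := t)) = 1 + t\<^sup>2 + 2 * t * sym_entry x i k" for t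
    unfolding quad_form_def
    using quadratic_form_split_two[of "sym_entry x" i n k "(\<lambda>_. 0)(i := 1, k := t)", OF sym_entry_commute ik] ik
    by (simp add: sym_entry_def[of x i i] sym_entry_def[of x k k])
  then have "0 \<le> 1 + t\<^sup>2 + 2 * t * sym_entry x i k" for t using x by metis
  from this[of 1] this[of "-1"] show ?thesis by simp
qed

lemma quad_form_cong:
  "(\<And>i. i < n \<Longrightarrow> v i = w i) \<Longrightarrow> quad_form n x v = quad_form n x w"
  by (auto simp: quad_form_def intro!: sum.cong)

text \<open>Bridge from matrices to coordinates: it turns the prescribed law into the uniform law on
  \<open>elliptope n\<close>.\<close>

lemma offdiag_image_correlation_matrices:
  "offdiag n ` correlation_matrices n = elliptope n"
proof -
  have entry: "C $$ (i, j) = sym_entry (offdiag n C) i j"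
    if "C \<in> correlation_matrices n" "i < n" "j < n" for C i j
  proof -
    have C: "C \<in> carrier_mat n n" "transpose_mat C = C" "C $$ (i, i) = 1"
      using that by (auto simp: correlation_matrices_def)
    have "C $$ (i, j) = C $$ (j, i)"
      using C(1,2) that(2,3) by (metis carrier_matD index_transpose_mat(1))
    then show ?thesis using that(2,3) C(3)
      by (auto simp: sym_entry_def offdiag_def edge_def pairs_def min_def max_def)
  qed
  have form: "scalar_prod v (mult_mat_vec C v) = quad_form n x (vec_index v)"
    if "C \<in> carrier_mat n n" "v \<in> carrier_vec n" "\<And>i j. i < n \<Longrightarrow> j < n \<Longrightarrow> C $$ (i, j) = sym_entry x i j"
    for C v x
    using that
    by (auto simp: scalar_prod_def quad_form_def sum_distrib_left lessThan_atLeast0 algebra_simps intro!: sum.cong)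
  show ?thesis
  proof (intro equalityI subsetI)
    fix x assume "x \<in> offdiag n ` correlation_matrices n"
    then obtain C where C: "C \<in> correlation_matrices n" and x: "x = offdiag n C" by auto
    have "0 \<le> quad_form n x u" for u
    proof -
      have "quad_form n x u = quad_form n x (vec_index (vec n u))"
        by (rule quad_form_cong) simp
      also have "\<dots> = scalar_prod (vec n u) (mult_mat_vec C (vec n u))"
        using C entry[OF C] by (intro form[symmetric]) (auto simp: correlation_matrices_def x)
      also have "\<dots> \<ge> 0" using C by (auto simp: correlation_matrices_def pos_semidef_def)
      finally show ?thesis .
    qed
    then show "x \<in> elliptope n" by (auto simp: elliptope_def x offdiag_def)
  next
    fix x assume x: "x \<in> elliptope n"
    define C where "C = mat n n (\<lambda>(i, j). sym_entry x i j)"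
    have "C \<in> correlation_matrices n"
      using x form[of C _ x]
      by (auto simp: correlation_matrices_def pos_semidef_def C_def elliptope_def sym_entry_def edge_commute)
    moreover have "offdiag n C = x"
      using x by (auto simp: offdiag_def C_def elliptope_def pairs_def sym_entry_def edge_def
          extensional_def fun_eq_iff)
    ultimately show "x \<in> offdiag n ` correlation_matrices n" by blast
  qed
qed

section \<open>Independence of the entries\<close>

lemma sets_offdiag_lebesgue [measurable_cong]:
  "sets (offdiag_lebesgue n) = sets (PiM (pairs n) (\<lambda>_. borel))"
  unfolding offdiag_lebesgue_def by (intro sets_PiM_cong) auto

lemma borel_measurable_quad_form [measurable]:
  "(\<lambda>x. quad_form n x v) \<in> borel_measurable (offdiag_lebesgue n)"
proof -
  have "(\<lambda>x. sym_entry x p q) \<in> borel_measurable (offdiag_lebesgue n)" if "p < n" "q < n" for p q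
  proof (cases "p = q")
    case False
    then have "edge p q \<in> pairs n" using that by (simp add: edge_in_pairs_iff)
    then show ?thesis using False by (simp add: sym_entry_def offdiag_lebesgue_def)
  qed (simp add: sym_entry_def)
  then show ?thesis unfolding quad_form_def by (intro borel_measurable_sum borel_measurable_times) auto
qed

text \<open>Positivity on integer vectors suffices, since their multiples are dense; this leaves countably many conditions.\<close>
lemma elliptope_measurable [measurable]: "elliptope n \<in> sets (offdiag_lebesgue n)"
proof -
  define W where "W = PiE {..<n} (\<lambda>_. range real_of_int)"
  have W: "countable W" unfolding W_def by (intro countable_PiE) auto
  have "elliptope n = space (offdiag_lebesgue n) \<inter> (\<Inter>w\<in>W. {x \<in> space (offdiag_lebesgue n). 0 \<le> quad_form n x w})"
  proof (intro equalityI subsetI)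
    fix x assume "x \<in> space (offdiag_lebesgue n) \<inter> (\<Inter>w\<in>W. {x \<in> space (offdiag_lebesgue n). 0 \<le> quad_form n x w})"
    then have x: "x \<in> extensional (pairs n)" "\<And>w. w \<in> W \<Longrightarrow> 0 \<le> quad_form n x w"
      by (auto simp: offdiag_lebesgue_def space_PiM PiE_def)
    have "0 \<le> quad_form n x v" for v
    proof -
      define w where "w N i = real_of_int \<lfloor>real N * v i\<rfloor> / real N" for N i
      have lim: "(\<lambda>N. w N i) \<longlonglongrightarrow> v i" for i
      proof (rule tendsto_sandwich[of "\<lambda>N. v i - 1 / real N" _ _ "\<lambda>N. v i"])
        show "\<forall>\<^sub>F N in sequentially. v i - 1 / real N \<le> w N i"
          using eventually_gt_at_top[of 0]
        proof eventually_elim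
          case (elim N)
          have "real N * v i - 1 \<le> real_of_int \<lfloor>real N * v i\<rfloor>" by linarith
          then have "(real N * v i - 1) / real N \<le> w N i"
            unfolding w_def by (rule divide_right_mono) simp
          then show ?case using elim by (simp add: diff_divide_distrib)
        qed
        show "\<forall>\<^sub>F N in sequentially. w N i \<le> v i"
          using eventually_gt_at_top[of 0]
        proof eventually_elim
          case (elim N)
          have "real_of_int \<lfloor>real N * v i\<rfloor> \<le> real N * v i" by linarith
          then show ?case using elim by (simp add: w_def field_simps)
        qed
        show "(\<lambda>N. v i - 1 / real N) \<longlonglongrightarrow> v i"
          using tendsto_diff[OF tendsto_const[of "v i"] lim_1_over_n[where 'a = real]] by simp
      qed simp
      have "(\<lambda>N. quad_form n x (w N)) \<longlonglongrightarrow> quad_form n x v"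
        unfolding quad_form_def by (intro tendsto_intros lim)
      moreover have "0 \<le> quad_form n x (w N)" for N
      proof -
        define u where "u = (\<lambda>i\<in>{..<n}. real_of_int \<lfloor>real N * v i\<rfloor>)"
        \<comment> \<open>Also true for N = 0: \<open>w 0\<close> vanishes and division by 0 yields
          0, so both sides are 0.\<close>
        have "quad_form n x (w N) = quad_form n x u / (real N * real N)"
          unfolding quad_form_def sum_divide_distrib
          by (intro sum.cong refl) (auto simp: w_def u_def)
        moreover have "u \<in> W" by (auto simp: u_def W_def)
        ultimately show ?thesis using x(2) by simp
      qed
      ultimately show ?thesis by (intro LIMSEQ_le_const) auto
    qed
    then show "x \<in> elliptope n" using x(1) by (simp add: elliptope_def)
  qed (auto simp: elliptope_def offdiag_lebesgue_def space_PiM PiE_def)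
  also have "\<dots> \<in> sets (offdiag_lebesgue n)"
  proof (intro sets.Int sets.countable_INT'[OF W])
    have "(\<lambda>i\<in>{..<n}. 0) \<in> W" by (force simp: W_def)
    then show "W \<noteq> {}" by blast
  qed auto
  finally show ?thesis .
qed

text \<open>The one-dimensional substitution, applied coordinate by coordinate. The shift may vary
  with the coordinate but the scale is common, so the determinant is a power of \<open>c\<close>;
  this is the shape of the pivot substitution once the submatrix is held fixed.\<close>

lemma nn_integral_PiM_lborel_affine:
  fixes b :: "'i \<Rightarrow> real"
  assumes "finite I" and c: "c \<noteq> 0" and "f \<in> borel_measurable (PiM I (\<lambda>_. lborel))"
  shows "(\<integral>\<^sup>+x. f x \<partial>PiM I (\<lambda>_. lborel)) =
    ennreal (\<bar>c\<bar> ^ card I) * (\<integral>\<^sup>+x. f (\<lambda>i\<in>I. b i + c * x i) \<partial>PiM I (\<lambda>_. lborel))"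
  using assms(1,3)
proof (induction I arbitrary: f rule: finite_induct)
  case empty
  then show ?case by (simp add: PiM_empty nn_integral_count_space_finite)
next
  case (insert j I)
  interpret product_sigma_finite "\<lambda>_::'i. lborel :: real measure" by standard
  note [measurable] = insert.prems
  have aff [measurable]: "(\<lambda>x. \<lambda>i\<in>J. b i + c * x i) \<in> PiM J (\<lambda>_. lborel) \<rightarrow>\<^sub>M PiM J (\<lambda>_. lborel)" for J
    by (intro measurable_restrict) auto
  have "(\<integral>\<^sup>+x. f x \<partial>PiM (insert j I) (\<lambda>_. lborel))
     = (\<integral>\<^sup>+x. (\<integral>\<^sup>+y. f (x(j := y)) \<partial>lborel) \<partial>PiM I (\<lambda>_. lborel))"
    using insert by (intro product_nn_integral_insert) auto
  also have "\<dots> = (\<integral>\<^sup>+x. \<bar>c\<bar> * (\<integral>\<^sup>+y. f (x(j := b j + c * y)) \<partial>lborel) \<partial>PiM I (\<lambda>_. lborel))"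
  proof (rule nn_integral_cong)
    fix x :: "'i \<Rightarrow> real" assume x: "x \<in> space (PiM I (\<lambda>_. lborel))"
    have "(\<lambda>y. f (x(j := y))) \<in> borel_measurable borel"
      using measurable_comp[OF measurable_component_update[OF x insert.hyps(2)] insert.prems]
      by (simp add: comp_def)
    from nn_integral_real_affine[OF this c]
    show "(\<integral>\<^sup>+y. f (x(j := y)) \<partial>lborel) = \<bar>c\<bar> * (\<integral>\<^sup>+y. f (x(j := b j + c * y)) \<partial>lborel)" .
  qed
  also have "\<dots> = \<bar>c\<bar> * (\<integral>\<^sup>+x. (\<integral>\<^sup>+y. f (x(j := b j + c * y)) \<partial>lborel) \<partial>PiM I (\<lambda>_. lborel))"
    by (intro nn_integral_cmult) measurable
  also have "(\<integral>\<^sup>+x. (\<integral>\<^sup>+y. f (x(j := b j + c * y)) \<partial>lborel) \<partial>PiM I (\<lambda>_. lborel)) =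
    ennreal (\<bar>c\<bar> ^ card I) * (\<integral>\<^sup>+x. (\<integral>\<^sup>+y. f ((\<lambda>i\<in>I. b i + c * x i)(j := b j + c * y)) \<partial>lborel) \<partial>PiM I (\<lambda>_. lborel))"
    by (intro insert.IH) measurable
  also have "(\<integral>\<^sup>+x. (\<integral>\<^sup>+y. f ((\<lambda>i\<in>I. b i + c * x i)(j := b j + c * y)) \<partial>lborel) \<partial>PiM I (\<lambda>_. lborel))
     = (\<integral>\<^sup>+x. (\<integral>\<^sup>+y. f (\<lambda>i\<in>insert j I. b i + c * (x(j := y)) i) \<partial>lborel) \<partial>PiM I (\<lambda>_. lborel))"
    using insert.hyps by (intro nn_integral_cong arg_cong[where f = f]) (auto simp: fun_eq_iff)
  also have "\<dots> = (\<integral>\<^sup>+x. f (\<lambda>i\<in>insert j I. b i + c * x i) \<partial>PiM (insert j I) (\<lambda>_. lborel))"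
    using insert.hyps by (intro product_nn_integral_insert[symmetric]) measurable
  moreover have "ennreal (\<bar>c\<bar> ^ card (insert j I)) = \<bar>c\<bar> * ennreal (\<bar>c\<bar> ^ card I)"
    using insert.hyps by (simp add: ennreal_mult')
  ultimately show ?case by (simp only: mult.assoc)
qed

section \<open>Fibres of the elliptope over one entry and a submatrix\<close>

definition away :: "nat \<Rightarrow> nat \<Rightarrow> (nat \<times> nat) set" where
  "away n i = {(p, q) \<in> pairs n. p \<noteq> i \<and> q \<noteq> i}"

text \<open>Unnormalised density of one entry. The exponent counts the remaining n - 2 off-diagonal
  entries of the row, each scaled by sqrt (1 - a^2).\<close>

definition entry_weight :: "nat \<Rightarrow> real \<Rightarrow> real" where
  "entry_weight n a = (if \<bar>a\<bar> < 1 then sqrt (1 - a\<^sup>2) ^ (n - 2) else 0)"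

lemma entry_weight_measurable [measurable]: "entry_weight n \<in> borel_measurable borel"
  unfolding entry_weight_def by measurable

lemma finite_away: "finite (away n i)"
  by (rule finite_subset[OF _ finite_pairs[of n]]) (auto simp: away_def)

text \<open>Blocks for Fubini: the pivot entry, the submatrix without row i, and the n - 2 remaining
  entries of row i, which get integrated out.\<close>

lemma pairs_pivot_decomp:
  assumes "i < n" "k < n" "i \<noteq> k"
  shows "insert (edge i k) (away n i) \<union> edge i ` ({..<n} - {i, k}) = pairs n" (is ?A)
    and "insert (edge i k) (away n i) \<inter> edge i ` ({..<n} - {i, k}) = {}" (is ?B)
    and "edge i k \<notin> away n i" (is ?C)
    and "card (edge i ` ({..<n} - {i, k})) = n - 2" (is ?D)
proof -
  have "p \<in> edge i ` ({..<n} - {i, k})" if p: "p \<in> pairs n" "p \<noteq> edge i k" "p \<notin> away n i" for p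
  proof -
    have "p = edge i (if fst p = i then snd p else fst p)"
      using p by (auto simp: away_def pairs_def edge_def)
    moreover have "(if fst p = i then snd p else fst p) \<in> {..<n} - {i, k}"
      using p by (auto simp: away_def pairs_def edge_def)
    ultimately show ?thesis by (rule image_eqI)
  qed
  then show ?A using assms by (auto simp: away_def edge_in_pairs_iff)
  show ?B ?C by (auto simp: away_def edge_def min_def max_def split: if_splits)
  have "inj_on (edge i) ({..<n} - {i, k})" by (auto simp: inj_on_def edge_eq_iff)
  then show ?D using assms by (simp add: card_image card_Diff_subset)
qed

text \<open>For a fixed submatrix d, the admissible completions of row i over pivot value a are an
  affine image of those over pivot value 0. The expression
  \<open>if fst p = i then snd p else fst p\<close> recovers q from p =
  \<open>edge i q\<close>.\<close>

lemma elliptope_affine_fibre: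
  assumes ik: "i < n" "k < n" "i \<noteq> k" and a: "\<bar>a\<bar> < 1"
  defines "e \<equiv> edge i k" and "Z \<equiv> edge i ` ({..<n} - {i, k})"
  shows "merge (insert e (away n i)) Z (d(e := a),
        \<lambda>p\<in>Z. a * sym_entry d k (if fst p = i then snd p else fst p) + sqrt (1 - a\<^sup>2) * z p) \<in> elliptope n
     \<longleftrightarrow> merge (insert e (away n i)) Z (d(e := 0), z) \<in> elliptope n"
    (is "?x \<in> _ \<longleftrightarrow> ?y \<in> _")
proof -
  have a2: "a\<^sup>2 < 1" using a by (simp add: abs_square_less_1)
  note decomp = pairs_pivot_decomp[OF ik, folded e_def Z_def]
  have disj: "insert e (away n i) \<inter> Z = {}" and e: "e \<notin> Z" "e \<notin> away n i"
    using decomp by auto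
  have entry_ik: "sym_entry (merge (insert e (away n i)) Z (d(e := b), w)) i k = b" for b w
    using ik e by (simp add: sym_entry_def merge_def e_def[symmetric])
  have entry_row: "sym_entry (merge (insert e (away n i)) Z (d(e := b), w)) i q = w (edge i q)"
    if "q < n" "q \<noteq> i" "q \<noteq> k" for b w q
  proof -
    have "edge i q \<in> Z" using that by (auto simp: Z_def)
    then show ?thesis using disj that by (auto simp: sym_entry_def merge_def)
  qed
  have entry_rest: "sym_entry (merge (insert e (away n i)) Z (d(e := b), w)) p q = sym_entry d p q"
    if "p < n" "q < n" "p \<noteq> i" "q \<noteq> i" for b w p q
  proof (cases "p = q")
    case False
    then have "edge p q \<in> away n i"
      using that by (auto simp: away_def edge_def pairs_def min_def max_def)
    then show ?thesis using False e by (auto simp: sym_entry_def merge_def)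
  qed (simp add: sym_entry_def)
  have "(\<forall>v. 0 \<le> quad_form n ?x v) \<longleftrightarrow> (\<forall>v. 0 \<le> quad_form n ?y v)"
  proof (rule quad_form_nonneg_pivot_iff[OF ik, where a = a and s = "sqrt (1 - a\<^sup>2)"])
    show "(sqrt (1 - a\<^sup>2))\<^sup>2 + a\<^sup>2 = 1" "sqrt (1 - a\<^sup>2) \<noteq> 0" using a2 by auto
    show "sym_entry ?x i k = a" "sym_entry ?y i k = 0" by (rule entry_ik)+
    fix q assume q: "q < n" "q \<noteq> i" "q \<noteq> k"
    have "edge i q \<in> Z" using q by (auto simp: Z_def)
    moreover have "(if fst (edge i q) = i then snd (edge i q) else fst (edge i q)) = q"
      by (auto simp: edge_def min_def max_def)
    ultimately show "sym_entry ?x i q = a * sym_entry ?y k q + sqrt (1 - a\<^sup>2) * sym_entry ?y i q"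
      using ik q by (simp add: entry_row entry_rest)
  qed (simp add: entry_rest)
  moreover have "merge (insert e (away n i)) Z (u, w) \<in> extensional (pairs n)" for u w :: "nat \<times> nat \<Rightarrow> real"
    using extensional_merge[of "insert e (away n i)" Z u w] by (simp only: decomp(1))
  ultimately show ?thesis by (simp only: elliptope_def mem_Collect_eq simp_thms)
qed

text \<open>The fibre over (d, a) has volume \<open>entry_weight n a\<close> times G d, where G d is
  the fibre volume over pivot value 0. With general test sets A and F, one formula yields the total
  volume, the marginals and the independence.\<close>

lemma emeasure_elliptope_factor:
  assumes ik: "i < n" "k < n" "i \<noteq> k"
  obtains G where "G \<in> borel_measurable (PiM (away n i) (\<lambda>_. lborel))"
    and "\<And>A F. A \<in> sets borel \<Longrightarrow> F \<in> sets (PiM (away n i) (\<lambda>_. lborel)) \<Longrightarrow>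
      emeasure (offdiag_lebesgue n) {x \<in> elliptope n. x (edge i k) \<in> A \<and> restrict x (away n i) \<in> F}
        = (\<integral>\<^sup>+a. ennreal (entry_weight n a) * indicator A a \<partial>lborel)
          * (\<integral>\<^sup>+d. G d * indicator F d \<partial>PiM (away n i) (\<lambda>_. lborel))"
proof -
  interpret product_sigma_finite "\<lambda>_::nat \<times> nat. lborel :: real measure" by standard
  define e where "e = edge i k"
  define D where "D = away n i"
  define Z where "Z = edge i ` ({..<n} - {i, k})"
  define L where "L I = PiM I (\<lambda>_::nat \<times> nat. lborel :: real measure)" for I
  note decomp = pairs_pivot_decomp[OF ik, folded e_def D_def Z_def]
  have fin: "finite D" "finite Z" by (auto simp: D_def Z_def finite_away)
  have L: "offdiag_lebesgue n = L (insert e D \<union> Z)"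
    by (simp only: offdiag_lebesgue_def L_def decomp(1))
  have meas_E [measurable]: "elliptope n \<in> sets (L (insert e D \<union> Z))"
    using elliptope_measurable[of n] by (simp add: L)
  define \<phi> :: "(nat \<times> nat \<Rightarrow> real) \<Rightarrow> real \<Rightarrow> (nat \<times> nat \<Rightarrow> real) \<Rightarrow> ennreal"
    where "\<phi> d a z = indicator (elliptope n) (merge (insert e D) Z (d(e := a), z))" for d a z
  define G where "G d = (\<integral>\<^sup>+z. \<phi> d 0 z \<partial>L Z)" for d
  have upd [measurable]: "(\<lambda>x. (fst x)(e := snd x)) \<in> L D \<Otimes>\<^sub>M borel \<rightarrow>\<^sub>M L (insert e D)"
    unfolding L_def by measurable
  have upd0 [measurable]: "(\<lambda>d. d(e := 0)) \<in> L D \<rightarrow>\<^sub>M L (insert e D)"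
    using measurable_compose[OF measurable_Pair[OF measurable_ident_sets[OF refl] measurable_const[of 0 borel]] upd]
    by simp
  have mrg [measurable]: "merge (insert e D) Z \<in> L (insert e D) \<Otimes>\<^sub>M L Z \<rightarrow>\<^sub>M L (insert e D \<union> Z)"
    unfolding L_def by measurable
  have sfZ: "sigma_finite_measure (L Z)"
    unfolding L_def by (rule sigma_finite[OF fin(2)])
  have meas_G: "G \<in> borel_measurable (L D)"
    unfolding G_def \<phi>_def by (intro sigma_finite_measure.borel_measurable_nn_integral[OF sfZ]) measurable
  have fibre: "(\<integral>\<^sup>+z. \<phi> d a z \<partial>L Z) = ennreal (entry_weight n a) * G d"
    if d: "d \<in> space (L D)" and a: "\<bar>a\<bar> \<noteq> 1" for d a
  proof (cases "\<bar>a\<bar> < 1")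
    case True
    then have a2: "a\<^sup>2 < 1" by (simp add: abs_square_less_1)
    have "d(e := a) \<in> space (L (insert e D))"
      using d by (auto simp: L_def space_PiM PiE_def extensional_def split: if_splits)
    then have [measurable]: "\<phi> d a \<in> borel_measurable (L Z)"
      unfolding \<phi>_def by measurable
    have "(\<integral>\<^sup>+z. \<phi> d a z \<partial>L Z) = ennreal (\<bar>sqrt (1 - a\<^sup>2)\<bar> ^ card Z)
      * (\<integral>\<^sup>+z. \<phi> d a (\<lambda>p\<in>Z. a * sym_entry d k (if fst p = i then snd p else fst p) + sqrt (1 - a\<^sup>2) * z p) \<partial>L Z)"
      unfolding L_def using a2 fin
      by (intro nn_integral_PiM_lborel_affine) (auto simp: L_def[symmetric])
    also have "\<bar>sqrt (1 - a\<^sup>2)\<bar> ^ card Z = entry_weight n a"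
      using True a2 by (simp add: entry_weight_def decomp(4))
    also have "(\<lambda>z. \<phi> d a (\<lambda>p\<in>Z. a * sym_entry d k (if fst p = i then snd p else fst p) + sqrt (1 - a\<^sup>2) * z p)) = \<phi> d 0"
      unfolding \<phi>_def e_def D_def Z_def
      by (intro ext) (simp only: indicator_def elliptope_affine_fibre[OF ik True])
    finally show ?thesis by (simp add: G_def)
  next
    case False
    \<comment> \<open>Here a has modulus above 1, so the entry at (i, k) alone rules out positivity
      and both sides are 0.\<close>
    have "merge (insert e D) Z (d(e := a), z) \<notin> elliptope n" for z
    proof
      assume "merge (insert e D) Z (d(e := a), z) \<in> elliptope n"
      then have "\<bar>sym_entry (merge (insert e D) Z (d(e := a), z)) i k\<bar> \<le> 1"
        using ik by (intro quad_form_nonneg_imp_abs_entry_le_1[of _ n]) (auto simp: elliptope_def)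
      then show False using False a ik decomp by (simp add: sym_entry_def merge_def e_def[symmetric])
    qed
    then show ?thesis using False by (simp add: \<phi>_def entry_weight_def)
  qed
  show thesis
  proof
    show "G \<in> borel_measurable (PiM (away n i) (\<lambda>_. lborel))"
      using meas_G by (simp add: L_def D_def)
    fix A and F :: "(nat \<times> nat \<Rightarrow> real) set"
    assume A [measurable]: "A \<in> sets (borel :: real measure)"
      and "F \<in> sets (PiM (away n i) (\<lambda>_. lborel))"
    then have F [measurable]: "F \<in> sets (L D)" by (simp add: L_def D_def)
    let ?S = "{x \<in> elliptope n. x e \<in> A \<and> restrict x D \<in> F}"
    have sub: "elliptope n \<subseteq> space (L (insert e D \<union> Z))"
      using sets.sets_into_space[OF meas_E] .
    have [measurable]: "(\<lambda>x. x e) \<in> L (insert e D \<union> Z) \<rightarrow>\<^sub>M borel"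
      "(\<lambda>x. restrict x D) \<in> L (insert e D \<union> Z) \<rightarrow>\<^sub>M L D"
      unfolding L_def by (auto intro!: measurable_restrict_subset)
    have "?S = elliptope n \<inter> {x \<in> space (L (insert e D \<union> Z)). x e \<in> A \<and> restrict x D \<in> F}"
      using sub by auto
    also have "\<dots> \<in> sets (L (insert e D \<union> Z))" by measurable
    finally have S [measurable]: "?S \<in> sets (L (insert e D \<union> Z))" .
    have "emeasure (offdiag_lebesgue n) ?S = (\<integral>\<^sup>+x. indicator ?S x \<partial>L (insert e D \<union> Z))"
      using S by (simp add: L)
    also have "\<dots> = (\<integral>\<^sup>+x. (\<integral>\<^sup>+z. indicator ?S (merge (insert e D) Z (x, z)) \<partial>L Z) \<partial>L (insert e D))"
      using decomp fin S unfolding L_def by (intro product_nn_integral_fold) auto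
    also have "\<dots> = (\<integral>\<^sup>+d. (\<integral>\<^sup>+a. (\<integral>\<^sup>+z. indicator ?S (merge (insert e D) Z (d(e := a), z)) \<partial>L Z) \<partial>lborel) \<partial>L D)"
    proof -
      have "(\<lambda>x. \<integral>\<^sup>+z. indicator ?S (merge (insert e D) Z (x, z)) \<partial>L Z) \<in> borel_measurable (L (insert e D))"
        by (intro sigma_finite_measure.borel_measurable_nn_integral[OF sfZ]) measurable
      then show ?thesis unfolding L_def[of "insert e D"] L_def[of D]
        using decomp fin by (intro product_nn_integral_insert) auto
    qed
    also have "\<dots> = (\<integral>\<^sup>+d. (\<integral>\<^sup>+a. (ennreal (entry_weight n a) * indicator A a) * (G d * indicator F d) \<partial>lborel) \<partial>L D)"
    proof (rule nn_integral_cong, rule nn_integral_cong_AE)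
      fix d assume d: "d \<in> space (L D)"
      \<comment> \<open>At a = 1 and a = -1 the substitution is singular. For n = 2 the fibre
        formula is even false there: the fibre is a point of mass 1 while the weight is 0. Only a
        null set is lost.\<close>
      have "AE a in lborel. a \<noteq> (1::real) \<and> a \<noteq> -1"
        using AE_lborel_singleton[of "1::real"] AE_lborel_singleton[of "-1::real"] by eventually_elim auto
      then show "AE a in lborel. (\<integral>\<^sup>+z. indicator ?S (merge (insert e D) Z (d(e := a), z)) \<partial>L Z)
        = (ennreal (entry_weight n a) * indicator A a) * (G d * indicator F d)"
      proof eventually_elim
        case (elim a)
        have "restrict (merge (insert e D) Z (d(e := a), z)) D = d" for z
          using d decomp by (auto simp: fun_eq_iff merge_def L_def space_PiM PiE_def extensional_def)
        moreover have "merge (insert e D) Z (d(e := a), z) e = a" for z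
          by (simp add: merge_def)
        ultimately have "indicator ?S (merge (insert e D) Z (d(e := a), z)) = \<phi> d a z * (indicator A a * indicator F d)" for z
          by (auto simp: \<phi>_def indicator_def)
        moreover have "\<phi> d a \<in> borel_measurable (L Z)"
        proof -
          have "d(e := a) \<in> space (L (insert e D))"
            using d by (auto simp: L_def space_PiM PiE_def extensional_def split: if_splits)
          then show ?thesis unfolding \<phi>_def by measurable
        qed
        ultimately have "(\<integral>\<^sup>+z. indicator ?S (merge (insert e D) Z (d(e := a), z)) \<partial>L Z)
           = (\<integral>\<^sup>+z. \<phi> d a z \<partial>L Z) * (indicator A a * indicator F d)"
          by (simp add: nn_integral_multc)
        also have "(\<integral>\<^sup>+z. \<phi> d a z \<partial>L Z) = ennreal (entry_weight n a) * G d"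
          using elim by (intro fibre d) (auto simp: abs_if)
        finally show ?case by (simp only: ac_simps)
      qed
    qed
    also have "\<dots> = (\<integral>\<^sup>+a. ennreal (entry_weight n a) * indicator A a \<partial>lborel) * (\<integral>\<^sup>+d. G d * indicator F d \<partial>L D)"
      using meas_G by (simp add: nn_integral_multc nn_integral_cmult)
    finally show "emeasure (offdiag_lebesgue n) {x \<in> elliptope n. x (edge i k) \<in> A \<and> restrict x (away n i) \<in> F}
        = (\<integral>\<^sup>+a. ennreal (entry_weight n a) * indicator A a \<partial>lborel)
          * (\<integral>\<^sup>+d. G d * indicator F d \<partial>PiM (away n i) (\<lambda>_. lborel))"
      by (simp add: L_def D_def e_def)
  qed
qed

text \<open>It depends on n alone, not on the pair; this is how all entries come to have the same
  law.\<close>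

definition entry_law :: "nat \<Rightarrow> real \<Rightarrow> ennreal" where
  "entry_law n a = ennreal (entry_weight n a) / (\<integral>\<^sup>+t. ennreal (entry_weight n t) \<partial>lborel)"

section \<open>Laws and independence of the entries of a random correlation matrix\<close>

locale random_correlation = prob_space M
  for M :: "'a measure" +
  fixes n :: nat and X :: "'a \<Rightarrow> nat \<times> nat \<Rightarrow> real"
  assumes X_measurable [measurable]: "X \<in> M \<rightarrow>\<^sub>M offdiag_lebesgue n"
    and distr_X: "distr M (offdiag_lebesgue n) X = uniform_measure (offdiag_lebesgue n) (elliptope n)"
begin

lemma entry_measurable [measurable]:
  "p \<in> pairs n \<Longrightarrow> (\<lambda>\<omega>. X \<omega> p) \<in> borel_measurable M"
  using measurable_compose[OF X_measurable, of "\<lambda>x. x p" borel]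
  by (simp add: offdiag_lebesgue_def)

lemma restrict_measurable [measurable]:
  "I \<subseteq> pairs n \<Longrightarrow> (\<lambda>\<omega>. restrict (X \<omega>) I) \<in> M \<rightarrow>\<^sub>M PiM I (\<lambda>_. lborel)"
  using measurable_compose[OF X_measurable, of "\<lambda>x. restrict x I" "PiM I (\<lambda>_. lborel)"]
  by (simp add: offdiag_lebesgue_def measurable_restrict_subset)

lemma emeasure_event:
  assumes "S \<in> sets (offdiag_lebesgue n)"
  shows "emeasure M {\<omega> \<in> space M. X \<omega> \<in> S} =
    emeasure (offdiag_lebesgue n) (elliptope n \<inter> S) / emeasure (offdiag_lebesgue n) (elliptope n)"
proof -
  have "emeasure M {\<omega> \<in> space M. X \<omega> \<in> S} = emeasure (distr M (offdiag_lebesgue n) X) S"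
    using assms by (subst emeasure_distr) (auto simp: vimage_def Int_def conj_commute)
  then show ?thesis using assms by (simp add: distr_X emeasure_uniform_measure)
qed

text \<open>Read off from the total mass 1: for extended nonnegative reals both 0 / 0 and top / top
  are 0, so a quotient equal to 1 excludes both.\<close>

lemma emeasure_elliptope:
  "emeasure (offdiag_lebesgue n) (elliptope n) \<noteq> 0" "emeasure (offdiag_lebesgue n) (elliptope n) \<noteq> \<top>"
proof -
  have "emeasure M {\<omega> \<in> space M. X \<omega> \<in> space (offdiag_lebesgue n)} = 1"
    using measurable_space[OF X_measurable] by (simp add: emeasure_space_1 cong: conj_cong)
  moreover have "elliptope n \<inter> space (offdiag_lebesgue n) = elliptope n"
    using sets.sets_into_space[OF elliptope_measurable] by blast
  ultimately have "emeasure (offdiag_lebesgue n) (elliptope n) / emeasure (offdiag_lebesgue n) (elliptope n) = 1"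
    using emeasure_event[of "space (offdiag_lebesgue n)"] by simp
  then show "emeasure (offdiag_lebesgue n) (elliptope n) \<noteq> 0" "emeasure (offdiag_lebesgue n) (elliptope n) \<noteq> \<top>"
    by (auto simp: ennreal_divide_top)
qed

text \<open>Dividing each factor of the volume formula by its own total mass exhibits the joint law
  as the product of the two marginals.\<close>

lemma entry_factor:
  assumes ik: "i < n" "k < n" "i \<noteq> k"
  shows "\<And>g :: _ \<Rightarrow> real. g \<in> borel_measurable (PiM (away n i) (\<lambda>_. lborel)) \<Longrightarrow>
      indep_var borel (\<lambda>\<omega>. X \<omega> (edge i k)) borel (\<lambda>\<omega>. g (restrict (X \<omega>) (away n i)))"
    and "\<And>A. A \<in> sets borel \<Longrightarrow> emeasure M {\<omega> \<in> space M. X \<omega> (edge i k) \<in> A} = (\<integral>\<^sup>+a\<in>A. entry_law n a \<partial>lborel)"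
proof -
  let ?L = "PiM (away n i) (\<lambda>_. lborel) :: (nat \<times> nat \<Rightarrow> real) measure"
  have e: "edge i k \<in> pairs n" and sub: "away n i \<subseteq> pairs n"
    using ik by (auto simp: edge_in_pairs_iff away_def)
  note [measurable] = entry_measurable[OF e] restrict_measurable[OF sub]
  define V where "V = emeasure (offdiag_lebesgue n) (elliptope n)"
  note V = emeasure_elliptope[folded V_def]
  from emeasure_elliptope_factor[OF ik] obtain G where
    G [measurable]: "G \<in> borel_measurable ?L" and factor:
    "\<And>A F. A \<in> sets borel \<Longrightarrow> F \<in> sets ?L \<Longrightarrow>
      emeasure (offdiag_lebesgue n) {x \<in> elliptope n. x (edge i k) \<in> A \<and> restrict x (away n i) \<in> F}
        = (\<integral>\<^sup>+a. ennreal (entry_weight n a) * indicator A a \<partial>lborel)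
          * (\<integral>\<^sup>+d. G d * indicator F d \<partial>?L)" by blast
  define H where "H = (\<integral>\<^sup>+a. ennreal (entry_weight n a) \<partial>lborel)"
  define K where "K = (\<integral>\<^sup>+d. G d \<partial>?L)"
  have joint: "emeasure M {\<omega> \<in> space M. X \<omega> (edge i k) \<in> A \<and> restrict (X \<omega>) (away n i) \<in> F} =
     (\<integral>\<^sup>+a. ennreal (entry_weight n a) * indicator A a \<partial>lborel) * (\<integral>\<^sup>+d. G d * indicator F d \<partial>?L) / V"
    if [measurable]: "A \<in> sets borel" "F \<in> sets ?L" for A F
  proof -
    let ?S = "{x \<in> space (offdiag_lebesgue n). x (edge i k) \<in> A \<and> restrict x (away n i) \<in> F}"
    have "(\<lambda>x. x (edge i k)) \<in> offdiag_lebesgue n \<rightarrow>\<^sub>M borel"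
      "(\<lambda>x. restrict x (away n i)) \<in> offdiag_lebesgue n \<rightarrow>\<^sub>M ?L"
      unfolding offdiag_lebesgue_def using e sub by (auto intro!: measurable_restrict_subset)
    then have "?S \<in> sets (offdiag_lebesgue n)" by measurable
    moreover have "{\<omega> \<in> space M. X \<omega> \<in> ?S} = {\<omega> \<in> space M. X \<omega> (edge i k) \<in> A \<and> restrict (X \<omega>) (away n i) \<in> F}"
      using measurable_space[OF X_measurable] by auto
    moreover have "elliptope n \<inter> ?S = {x \<in> elliptope n. x (edge i k) \<in> A \<and> restrict x (away n i) \<in> F}"
      using sets.sets_into_space[OF elliptope_measurable[of n]] by blast
    ultimately show ?thesis
      using emeasure_event[of ?S] factor[OF that] by (simp add: V_def)
  qed
  have sp: "restrict (X \<omega>) (away n i) \<in> space ?L" if "\<omega> \<in> space M" for \<omega>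
    using that by (auto simp: space_PiM)
  have VHK: "V = H * K"
  proof -
    have "{x \<in> elliptope n. x (edge i k) \<in> UNIV \<and> restrict x (away n i) \<in> space ?L} = elliptope n"
      by (auto simp: space_PiM)
    then show ?thesis
      using factor[of UNIV "space ?L"] by (simp add: V_def H_def K_def cong: nn_integral_cong)
  qed
  \<comment> \<open>A product that is neither 0 nor infinite forces the same on both factors; in
    particular G has finite integral without any direct estimate.\<close>
  have HK: "H \<noteq> 0" "H \<noteq> \<top>" "K \<noteq> 0" "K \<noteq> \<top>"
    using V unfolding VHK by (auto simp: ennreal_mult_eq_top_iff)
  have quot: "x * y / (H * K) = (x / H) * (y / K)" for x y
    using HK by (simp add: divide_ennreal_def ennreal_inverse_mult less_top ac_simps)
  have one: "x / x = 1" if "x \<noteq> 0" "x \<noteq> \<top>" for x :: ennreal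
    using that by (simp add: ennreal_divide_self less_top)
  have joint': "emeasure M {\<omega> \<in> space M. X \<omega> (edge i k) \<in> A \<and> restrict (X \<omega>) (away n i) \<in> F} =
     (\<integral>\<^sup>+a. ennreal (entry_weight n a) * indicator A a \<partial>lborel) / H * ((\<integral>\<^sup>+d. G d * indicator F d \<partial>?L) / K)"
    if "A \<in> sets borel" "F \<in> sets ?L" for A F
    unfolding joint[OF that] VHK quot ..
  have left: "emeasure M {\<omega> \<in> space M. X \<omega> (edge i k) \<in> A} =
     (\<integral>\<^sup>+a. ennreal (entry_weight n a) * indicator A a \<partial>lborel) / H"
    if A: "A \<in> sets borel" for A
  proof -
    have "{\<omega> \<in> space M. X \<omega> (edge i k) \<in> A} =
       {\<omega> \<in> space M. X \<omega> (edge i k) \<in> A \<and> restrict (X \<omega>) (away n i) \<in> space ?L}" using sp by blast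
    moreover have "(\<integral>\<^sup>+d. G d * indicator (space ?L) d \<partial>?L) / K = 1"
      using one[OF HK(3,4)] by (simp add: K_def cong: nn_integral_cong)
    ultimately show ?thesis using joint'[OF A sets.top[of ?L]] by simp
  qed
  have right: "emeasure M {\<omega> \<in> space M. restrict (X \<omega>) (away n i) \<in> F} =
     (\<integral>\<^sup>+d. G d * indicator F d \<partial>?L) / K"
    if F: "F \<in> sets ?L" for F
    using joint'[OF _ F, of UNIV] one[OF HK(1,2)] by (simp add: H_def)
  show "emeasure M {\<omega> \<in> space M. X \<omega> (edge i k) \<in> A} = (\<integral>\<^sup>+a\<in>A. entry_law n a \<partial>lborel)"
    if [measurable]: "A \<in> sets borel" for A
    unfolding left[OF that] entry_law_def H_def[symmetric] divide_ennreal_def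
    by (subst nn_integral_multc[symmetric]) (auto simp: ac_simps)
  fix g :: "(nat \<times> nat \<Rightarrow> real) \<Rightarrow> real" assume g [measurable]: "g \<in> borel_measurable ?L"
  show "indep_var borel (\<lambda>\<omega>. X \<omega> (edge i k)) borel (\<lambda>\<omega>. g (restrict (X \<omega>) (away n i)))"
    unfolding indep_var_distribution_eq
  proof (intro conjI)
    let ?S = "distr M borel (\<lambda>\<omega>. X \<omega> (edge i k))"
    let ?T = "distr M borel (\<lambda>\<omega>. g (restrict (X \<omega>) (away n i)))"
    let ?J = "distr M (borel \<Otimes>\<^sub>M borel) (\<lambda>\<omega>. (X \<omega> (edge i k), g (restrict (X \<omega>) (away n i))))"
    show "?S \<Otimes>\<^sub>M ?T = ?J"
    proof (rule pair_measure_eqI)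
      show "sigma_finite_measure ?S" "sigma_finite_measure ?T"
        by (auto intro!: prob_space_imp_sigma_finite prob_space_distr)
      show "sets (?S \<Otimes>\<^sub>M ?T) = sets ?J"
        by (simp cong: sets_pair_measure_cong)
      fix A F assume "A \<in> sets ?S" "F \<in> sets ?T"
      then have [measurable]: "A \<in> sets borel" "F \<in> sets borel" by auto
      have F: "g -` F \<inter> space ?L \<in> sets ?L" by measurable
      have "emeasure ?S A = emeasure M {\<omega> \<in> space M. X \<omega> (edge i k) \<in> A}"
        by (subst emeasure_distr) (auto simp: vimage_def Int_def conj_commute)
      moreover have "emeasure ?T F = emeasure M {\<omega> \<in> space M. restrict (X \<omega>) (away n i) \<in> g -` F \<inter> space ?L}"
        using sp by (subst emeasure_distr) (auto simp: vimage_def Int_def conj_commute intro!: arg_cong[where f = "emeasure M"])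
      moreover have "emeasure ?J (A \<times> F)
         = emeasure M {\<omega> \<in> space M. X \<omega> (edge i k) \<in> A \<and> restrict (X \<omega>) (away n i) \<in> g -` F \<inter> space ?L}"
        using sp by (subst emeasure_distr) (auto simp: vimage_def Int_def conj_commute intro!: arg_cong[where f = "emeasure M"])
      ultimately show "emeasure ?S A * emeasure ?T F = emeasure ?J (A \<times> F)"
        using left[of A] right[OF F] joint'[OF _ F, of A] by simp
    qed
  qed auto
qed

end

section \<open>Multivariate Poisson approximation\<close>

lemma pmf_Poisson: "0 \<le> r \<Longrightarrow> pmf (Poisson r) k = r ^ k / fact k * exp (- r)"
  by (cases "r = 0") (auto simp: Poisson_def power_0_left)

text \<open>Power series form of the mean with the normalisation moved to the right; it supplies the
  vanishing sum behind the Stein equation at w = 0.\<close>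

lemma Poisson_expectation_sums:
  fixes f :: "nat \<Rightarrow> real"
  assumes "0 \<le> r" and "\<And>k. \<bar>f k\<bar> \<le> c"
  shows "(\<lambda>k. r ^ k / fact k * f k) sums (exp r * measure_pmf.expectation (Poisson r) f)"
proof -
  have "integrable (measure_pmf (Poisson r)) f"
    using assms(2) by (intro measure_pmf.integrable_const_bound[where B = c]) auto
  then have "integrable (count_space UNIV) (\<lambda>k. pmf (Poisson r) k * f k)"
    by (simp add: measure_pmf_eq_density[of "Poisson r"] integrable_density)
  then have "(\<lambda>k. pmf (Poisson r) k * f k) sums (\<integral>k. pmf (Poisson r) k * f k \<partial>count_space UNIV)"
    by (rule sums_integral_count_space_nat)
  also have "(\<integral>k. pmf (Poisson r) k * f k \<partial>count_space UNIV) = measure_pmf.expectation (Poisson r) f"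
    by (simp add: measure_pmf_eq_density[of "Poisson r"] integral_density)
  finally have "(\<lambda>k. exp r * (pmf (Poisson r) k * f k)) sums (exp r * measure_pmf.expectation (Poisson r) f)"
    by (rule sums_mult)
  then show ?thesis by (simp add: pmf_Poisson[OF assms(1)] exp_minus field_simps)
qed

text \<open>Summing over the values above \<^term>\<open>w\<close> rather than below gives a formula that remains valid for rate 0.\<close>
definition stein_solution :: "real \<Rightarrow> (nat \<Rightarrow> real) \<Rightarrow> nat \<Rightarrow> real" where
  "stein_solution r f w = (case w of 0 \<Rightarrow> 0 | Suc k \<Rightarrow>
     - (\<Sum>i. r ^ i * fact k / fact (k + 1 + i) * (f (k + 1 + i) - measure_pmf.expectation (Poisson r) f)))"

lemma expectation_in_unit_interval:
  fixes f :: "nat \<Rightarrow> real"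
  assumes "\<And>k. f k \<in> {0..1}"
  shows "measure_pmf.expectation p f \<in> {0..1}"
proof -
  have "integrable (measure_pmf p) f"
    using assms by (intro measure_pmf.integrable_const_bound[where B = 1]) auto
  then show ?thesis
    using assms by (auto intro!: integral_nonneg measure_pmf.integral_le_const)
qed

context
  fixes r :: real and f :: "nat \<Rightarrow> real"
  assumes r: "0 \<le> r" and f: "\<And>k. f k \<in> {0..1}"
begin

abbreviation (input) "stein_term k i \<equiv>
  r ^ i * fact k / fact (k + 1 + i) * (f (k + 1 + i) - measure_pmf.expectation (Poisson r) f)"

lemma centred_bound: "\<bar>f k - measure_pmf.expectation (Poisson r) f\<bar> \<le> 1"
proof -
  have "measure_pmf.expectation (Poisson r) f \<in> {0..1}"
    by (rule expectation_in_unit_interval) (rule f)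
  with f[of k] show ?thesis unfolding atLeastAtMost_iff by linarith
qed

text \<open>k! i! divides (k + i)!, so the terms are dominated by the exponential series uniformly
  in k. This gives both summability and the bound exp r.\<close>

lemma stein_term_bound: "norm (stein_term k i) \<le> r ^ i / fact i"
proof -
  have "(fact k * fact i :: real) \<le> fact (k + 1 + i)"
  proof -
    have "(fact k * fact i :: nat) \<le> fact (k + i)"
      by (intro dvd_imp_le fact_fact_dvd_fact) simp
    also have "\<dots> \<le> fact (k + 1 + i)" by (intro fact_mono_nat) simp
    finally have "real (fact k * fact i) \<le> real (fact (k + 1 + i))" by (rule of_nat_mono)
    then show ?thesis by (simp only: of_nat_mult of_nat_fact)
  qed
  then have "r ^ i * fact k / fact (k + 1 + i) \<le> r ^ i / fact i"
    using r by (simp add: field_simps del: fact_Suc) (metis mult.assoc mult.commute mult_left_mono zero_le_power)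
  moreover have "\<bar>stein_term k i\<bar> \<le> r ^ i * fact k / fact (k + 1 + i) * 1"
    unfolding abs_mult using r centred_bound[of "k + 1 + i"]
    by (intro mult_mono) auto
  ultimately show ?thesis by simp
qed

lemma stein_term_summable: "summable (stein_term k)"
  by (rule summable_comparison_test'[of "\<lambda>i. r ^ i / fact i" 0])
    (use summable_exp[of r] stein_term_bound in \<open>auto simp: field_simps\<close>)

lemma stein_solution_bound: "\<bar>stein_solution r f w\<bar> \<le> exp r"
proof (cases w)
  case (Suc k)
  have exp: "(\<lambda>i. r ^ i / fact i) sums exp r"
    using exp_converges[of r] by (simp add: field_simps)
  have "\<bar>\<Sum>i. stein_term k i\<bar> \<le> (\<Sum>i. r ^ i / fact i)"
    using norm_suminf_le[OF stein_term_bound sums_summable[OF exp]] by simp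
  then show ?thesis using exp Suc by (simp add: stein_solution_def sums_iff)
qed (simp add: stein_solution_def)

text \<open>No division by r occurs, so r = 0 is covered. For w = k + 1 the zeroth term of the
  series is the centred value of f at w divided by w, and the later terms, multiplied by w, form r
  times the series for w + 1. For w = 0 the claim says that the centred f has Poisson mean
  0.\<close>

lemma stein_equation:
  "r * stein_solution r f (Suc w) - real w * stein_solution r f w
     = f w - measure_pmf.expectation (Poisson r) f"
proof (cases w)
  case 0
  let ?h = "\<lambda>j. f j - measure_pmf.expectation (Poisson r) f"
  have exp: "(\<lambda>i. r ^ i / fact i) sums exp r"
    using exp_converges[of r] by (simp add: field_simps)
  have "(\<lambda>j. r ^ j / fact j * f j - r ^ j / fact j * measure_pmf.expectation (Poisson r) f) sums
      (exp r * measure_pmf.expectation (Poisson r) f - exp r * measure_pmf.expectation (Poisson r) f)"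
    by (intro sums_diff sums_mult2[OF exp] Poisson_expectation_sums[OF r, of f 1]) (use f in auto)
  then have "(\<lambda>j. r ^ j / fact j * ?h j) sums 0" by (simp add: algebra_simps)
  then have "(\<lambda>j. r ^ Suc j / fact (Suc j) * ?h (Suc j)) sums (0 - r ^ 0 / fact 0 * ?h 0)"
    by (subst sums_Suc_iff) simp
  then have "(\<lambda>j. r * stein_term 0 j) sums (- ?h 0)"
    by (simp add: mult.assoc del: fact_Suc)
  moreover have "(\<Sum>j. r * stein_term 0 j) = r * (\<Sum>j. stein_term 0 j)"
    by (intro suminf_mult stein_term_summable)
  ultimately show ?thesis using 0 by (simp add: stein_solution_def sums_iff)
next
  case (Suc k)
  have "(\<Sum>i. stein_term k i) = stein_term k 0 + (\<Sum>i. stein_term k (Suc i))"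
    using suminf_split_head[OF stein_term_summable[of k]] by simp
  moreover have "real (Suc k) * stein_term k 0 = f w - measure_pmf.expectation (Poisson r) f"
  proof -
    have "real (Suc k) * (fact k / fact (k + 1)) = 1" by (simp del: of_nat_Suc)
    then have "real (Suc k) * (fact k / fact (k + 1)) * (f w - measure_pmf.expectation (Poisson r) f)
      = f w - measure_pmf.expectation (Poisson r) f" by (simp only: mult_1)
    then show ?thesis using Suc by (simp only: mult.assoc power_0 mult_1 add_0_right Suc_eq_plus1)
  qed
  moreover have "real (Suc k) * (\<Sum>i. stein_term k (Suc i)) = r * (\<Sum>i. stein_term (Suc k) i)"
  proof -
    have "real (Suc k) * (\<Sum>i. stein_term k (Suc i)) = (\<Sum>i. real (Suc k) * stein_term k (Suc i))"
      using stein_term_summable[of k] summable_Suc_iff[of "stein_term k"] by (intro suminf_mult[symmetric]) blast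
    also have "\<dots> = (\<Sum>i. r * stein_term (Suc k) i)"
      by (intro suminf_cong) (simp add: mult.assoc)
    also have "\<dots> = r * (\<Sum>i. stein_term (Suc k) i)"
      by (intro suminf_mult stein_term_summable)
    finally show ?thesis .
  qed
  ultimately have "real w * (\<Sum>i. stein_term k i) =
      f w - measure_pmf.expectation (Poisson r) f + r * (\<Sum>i. stein_term w i)"
    unfolding Suc by (simp only: distrib_left)
  moreover have "stein_solution r f (Suc w) = - (\<Sum>i. stein_term w i)"
    "stein_solution r f w = - (\<Sum>i. stein_term k i)"
    by (simp_all only: stein_solution_def Suc nat.case)
  ultimately show ?thesis by simp
qed

end

section \<open>Count vectors of dependent marks\<close>

definition mark_counts :: "'r set \<Rightarrow> ('r \<Rightarrow> 's set) \<Rightarrow> ('i \<Rightarrow> 's) \<Rightarrow> 'i set \<Rightarrow> 'r \<Rightarrow> nat" where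
  "mark_counts R B y J = (\<lambda>s\<in>R. card {\<alpha> \<in> J. y \<alpha> \<in> B s})"

lemma mark_counts_measurable:
  assumes "finite J" and "\<And>\<alpha> s. \<alpha> \<in> J \<Longrightarrow> s \<in> R \<Longrightarrow> Measurable.pred M (\<lambda>\<omega>. Y \<alpha> \<omega> \<in> B s)"
  shows "(\<lambda>\<omega>. mark_counts R B (\<lambda>\<alpha>. Y \<alpha> \<omega>) J) \<in> M \<rightarrow>\<^sub>M PiM R (\<lambda>_. count_space UNIV)"
  unfolding mark_counts_def
proof (rule measurable_restrict)
  fix s assume s: "s \<in> R"
  show "(\<lambda>\<omega>. card {\<alpha> \<in> J. Y \<alpha> \<omega> \<in> B s}) \<in> M \<rightarrow>\<^sub>M count_space UNIV"
    using assms
  proof (induction J rule: finite_induct)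
    case (insert \<alpha> J)
    have "card {\<beta> \<in> insert \<alpha> J. Y \<beta> \<omega> \<in> B s} = (if Y \<alpha> \<omega> \<in> B s then 1 else 0) + card {\<beta> \<in> J. Y \<beta> \<omega> \<in> B s}" for \<omega>
    proof -
      have "{\<beta> \<in> insert \<alpha> J. Y \<beta> \<omega> \<in> B s} = (if Y \<alpha> \<omega> \<in> B s then insert \<alpha> {\<beta> \<in> J. Y \<beta> \<omega> \<in> B s} else {\<beta> \<in> J. Y \<beta> \<omega> \<in> B s})"
        by auto
      then show ?thesis using insert.hyps by simp
    qed
    moreover have "Measurable.pred M (\<lambda>\<omega>. Y \<alpha> \<omega> \<in> B s)"
      using insert.prems s by simp
    moreover have "(\<lambda>\<omega>. card {\<beta> \<in> J. Y \<beta> \<omega> \<in> B s}) \<in> M \<rightarrow>\<^sub>M count_space UNIV"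
      using insert by auto
    ultimately show ?case by simp
  qed simp
qed

text \<open>A finite product of countable discrete spaces is discrete, so every function of the
  count vector is measurable and \<phi> needs no regularity.\<close>

lemma mark_counts_comp_measurable:
  fixes \<phi> :: "('r \<Rightarrow> nat) \<Rightarrow> real"
  assumes "finite R" "finite J"
    and "\<And>\<alpha> s. \<alpha> \<in> J \<Longrightarrow> s \<in> R \<Longrightarrow> Measurable.pred M (\<lambda>\<omega>. Y \<alpha> \<omega> \<in> B s)"
  shows "(\<lambda>\<omega>. \<phi> (mark_counts R B (\<lambda>\<alpha>. Y \<alpha> \<omega>) J)) \<in> borel_measurable M"
proof -
  have "PiM R (\<lambda>_. count_space (UNIV :: nat set)) = count_space (PiE R (\<lambda>_. UNIV))"
    using assms(1) by (intro count_space_PiM_finite) auto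
  then show ?thesis
    using measurable_compose[where g = \<phi> and L = borel, OF mark_counts_measurable[OF assms(2,3)]] by simp
qed

lemma (in prob_space) has_bochner_integral_of_bool:
  assumes "{\<omega> \<in> space M. P \<omega>} \<in> events"
  shows "has_bochner_integral M (\<lambda>\<omega>. of_bool (P \<omega>) :: real) (prob {\<omega> \<in> space M. P \<omega>})"
proof -
  have "has_bochner_integral M (indicator {\<omega> \<in> space M. P \<omega>} :: _ \<Rightarrow> real) (prob {\<omega> \<in> space M. P \<omega>})"
    using assms by (intro has_bochner_integral_real_indicator) (auto simp: emeasure_eq_measure)
  then show ?thesis
    by (rule has_bochner_integral_cong[THEN iffD1, rotated -1]) auto
qed

text \<open>\<open>indep_N\<close> is a weak form of independence: it only asks for factorisation
  against bounded functions of the counts outside the neighbourhood, which is exactly what the Stein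
  argument consumes.\<close>

locale dependent_marks = prob_space M
  for M :: "'a measure" +
  fixes \<Gamma> :: "'i set" and S :: "'s measure" and Y :: "'i \<Rightarrow> 'a \<Rightarrow> 's"
    and R :: "'r set" and B :: "'r \<Rightarrow> 's set" and N :: "'i \<Rightarrow> 'i set"
  assumes finite_\<Gamma>: "finite \<Gamma>" and finite_R: "finite R"
    and Y_measurable: "\<And>\<alpha>. \<alpha> \<in> \<Gamma> \<Longrightarrow> Y \<alpha> \<in> M \<rightarrow>\<^sub>M S"
    and B_sets: "\<And>r. r \<in> R \<Longrightarrow> B r \<in> sets S"
    and disjoint_B: "disjoint_family_on B R"
    and self_N: "\<And>\<alpha>. \<alpha> \<in> \<Gamma> \<Longrightarrow> \<alpha> \<in> N \<alpha>"
    and indep_N: "\<And>\<alpha> r \<phi>. \<alpha> \<in> \<Gamma> \<Longrightarrow> r \<in> R \<Longrightarrow> bounded (range \<phi>) \<Longrightarrow>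
      (\<integral>\<omega>. indicator (B r) (Y \<alpha> \<omega>) * (\<phi> (mark_counts R B (\<lambda>\<beta>. Y \<beta> \<omega>) (\<Gamma> - N \<alpha>)) :: real) \<partial>M)
        = measure M {\<omega> \<in> space M. Y \<alpha> \<omega> \<in> B r} * (\<integral>\<omega>. \<phi> (mark_counts R B (\<lambda>\<beta>. Y \<beta> \<omega>) (\<Gamma> - N \<alpha>)) \<partial>M)"
begin

abbreviation counts :: "'i set \<Rightarrow> 'a \<Rightarrow> 'r \<Rightarrow> nat" where
  "counts J \<omega> \<equiv> mark_counts R B (\<lambda>\<alpha>. Y \<alpha> \<omega>) J"

definition rate :: "'r \<Rightarrow> real" where
  "rate r = (\<Sum>\<alpha>\<in>\<Gamma>. prob {\<omega> \<in> space M. Y \<alpha> \<omega> \<in> B r})"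

text \<open>The two usual Chen-Stein sums; the third, which measures dependence on the counts
  outside the neighbourhood, vanishes by \<open>indep_N\<close>. Neighbours enter with the union of
  all B s because a mark in any of them alters the count vector. The factor 2 exp (rate r) bounds
  the difference of two values of the Stein solution.\<close>

definition dependence_error :: "'r \<Rightarrow> real" where
  "dependence_error r = 2 * exp (rate r) * (\<Sum>\<alpha>\<in>\<Gamma>.
     prob {\<omega> \<in> space M. Y \<alpha> \<omega> \<in> B r} * (\<Sum>\<beta>\<in>\<Gamma> \<inter> N \<alpha>. prob {\<omega> \<in> space M. Y \<beta> \<omega> \<in> (\<Union>s\<in>R. B s)})
     + (\<Sum>\<beta>\<in>\<Gamma> \<inter> N \<alpha> - {\<alpha>}. prob {\<omega> \<in> space M. Y \<alpha> \<omega> \<in> B r \<and> Y \<beta> \<omega> \<in> (\<Union>s\<in>R. B s)}))"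

lemma event_sets [measurable]:
  "\<alpha> \<in> \<Gamma> \<Longrightarrow> r \<in> R \<Longrightarrow> {\<omega> \<in> space M. Y \<alpha> \<omega> \<in> B r} \<in> events"
  using measurable_sets[OF Y_measurable B_sets, of \<alpha> r] by (simp add: vimage_def Int_def conj_commute)

lemma Union_event_sets [measurable]:
  assumes "\<alpha> \<in> \<Gamma>" shows "{\<omega> \<in> space M. Y \<alpha> \<omega> \<in> (\<Union>s\<in>R. B s)} \<in> events"
proof -
  have "(\<Union>s\<in>R. B s) \<in> sets S" using finite_R B_sets by (intro sets.finite_UN) auto
  from measurable_sets[OF Y_measurable[OF assms] this] show ?thesis
    by (simp add: vimage_def Int_def conj_commute)
qed

lemma counts_measurable: "J \<subseteq> \<Gamma> \<Longrightarrow> counts J \<in> M \<rightarrow>\<^sub>M PiM R (\<lambda>_. count_space UNIV)"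
  using event_sets finite_subset[OF _ finite_\<Gamma>]
  by (intro mark_counts_measurable) (auto simp: pred_def)

lemma counts_comp_measurable:
  fixes \<phi> :: "('r \<Rightarrow> nat) \<Rightarrow> real"
  shows "J \<subseteq> \<Gamma> \<Longrightarrow> (\<lambda>\<omega>. \<phi> (counts J \<omega>)) \<in> borel_measurable M"
  using event_sets finite_subset[OF _ finite_\<Gamma>] finite_R
  by (intro mark_counts_comp_measurable) (auto simp: pred_def)

lemma counts_comp_integrable:
  fixes \<phi> :: "('r \<Rightarrow> nat) \<Rightarrow> real"
  assumes "J \<subseteq> \<Gamma>" "\<And>v. \<bar>\<phi> v\<bar> \<le> c"
  shows "integrable M (\<lambda>\<omega>. \<phi> (counts J \<omega>))"
  using assms by (intro integrable_const_bound[where B = c] counts_comp_measurable) auto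

text \<open>By disjointness a mark in B r lies in no other B s, so exactly one coordinate
  moves.\<close>

lemma counts_insert_index:
  assumes "\<alpha> \<notin> J" "finite J" "r \<in> R" "Y \<alpha> \<omega> \<in> B r"
  shows "counts (insert \<alpha> J) \<omega> = (counts J \<omega>)(r := Suc (counts J \<omega> r))"
proof
  fix s
  have "{\<beta> \<in> insert \<alpha> J. Y \<beta> \<omega> \<in> B s} = (if s = r then insert \<alpha> {\<beta> \<in> J. Y \<beta> \<omega> \<in> B s} else {\<beta> \<in> J. Y \<beta> \<omega> \<in> B s})"
    if "s \<in> R"
    using that assms disjoint_B by (auto simp: disjoint_family_on_def)
  then show "counts (insert \<alpha> J) \<omega> s = ((counts J \<omega>)(r := Suc (counts J \<omega> r))) s"
    using assms by (auto simp: mark_counts_def)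
qed

text \<open>The Stein equation in coordinate r, evaluated at the count vector, splits into one term
  per index. In each term the counts are recomputed without the neighbourhood of that index: the new
  term has mean 0, and the exchange costs something only when a neighbour is marked.\<close>

lemma replace_coordinate:
  fixes F :: "('r \<Rightarrow> nat) \<Rightarrow> real"
  assumes F: "\<And>v. F v \<in> {0..1}" and r: "r \<in> R"
  shows "\<bar>expectation (\<lambda>\<omega>. F (counts \<Gamma> \<omega>))
    - expectation (\<lambda>\<omega>. measure_pmf.expectation (Poisson (rate r)) (\<lambda>k. F ((counts \<Gamma> \<omega>)(r := k))))\<bar>
    \<le> dependence_error r"
proof -
  define p where "p \<alpha> = prob {\<omega> \<in> space M. Y \<alpha> \<omega> \<in> B r}" for \<alpha>
  define U where "U = (\<Union>s\<in>R. B s)"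
  define c where "c = exp (rate r)"
  define g where "g v = stein_solution (rate r) (\<lambda>k. F (v(r := k)))" for v
  define H where "H v = g v (Suc (v r))" for v
  define E where "E v = measure_pmf.expectation (Poisson (rate r)) (\<lambda>k. F (v(r := k)))" for v
  \<comment> \<open>\<open>T\<close> is the share of one index in the Stein operator.
    \<open>T0\<close> uses the counts outside \<open>N \<alpha>\<close> and has H in both halves: if
    \<alpha> is marked, its own mark raises coordinate r by one, which is the shift inside
    H.\<close>
  define T where "T \<alpha> \<omega> = p \<alpha> * H (counts \<Gamma> \<omega>)
    - of_bool (Y \<alpha> \<omega> \<in> B r) * g (counts \<Gamma> \<omega>) (counts \<Gamma> \<omega> r)" for \<alpha> \<omega>
  define T0 where "T0 \<alpha> \<omega> = (p \<alpha> - of_bool (Y \<alpha> \<omega> \<in> B r)) * H (counts (\<Gamma> - N \<alpha>) \<omega>)" for \<alpha> \<omega>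
  define b where "b \<alpha> = 2 * c * (p \<alpha> * (\<Sum>\<beta>\<in>\<Gamma> \<inter> N \<alpha>. prob {\<omega> \<in> space M. Y \<beta> \<omega> \<in> U})
     + (\<Sum>\<beta>\<in>\<Gamma> \<inter> N \<alpha> - {\<alpha>}. prob {\<omega> \<in> space M. Y \<alpha> \<omega> \<in> B r \<and> Y \<beta> \<omega> \<in> U}))" for \<alpha>
  have rate: "0 \<le> rate r" unfolding rate_def by (intro sum_nonneg) auto
  have p: "0 \<le> p \<alpha>" "p \<alpha> \<le> 1" for \<alpha> by (auto simp: p_def)
  have g_bound: "\<bar>g v k\<bar> \<le> c" for v k
    unfolding g_def c_def by (rule stein_solution_bound[OF rate F])
  have H_bound: "\<bar>H v\<bar> \<le> c" for v unfolding H_def by (rule g_bound)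
  have c0: "0 \<le> c" by (simp add: c_def)
  \<comment> \<open>Coordinate r of the parameter is overwritten before F is evaluated, so g ignores
    it.\<close>
  have g_upd: "g (v(r := k)) = g v" for v k by (simp add: g_def)
  have E_bound: "E v \<in> {0..1}" for v
    unfolding E_def by (rule expectation_in_unit_interval) (rule F)
  have fin: "finite (\<Gamma> \<inter> A)" "finite (\<Gamma> - A)" for A using finite_\<Gamma> by auto
  have ev [measurable]: "Measurable.pred M (\<lambda>\<omega>. Y \<alpha> \<omega> \<in> B r)" "Measurable.pred M (\<lambda>\<omega>. Y \<alpha> \<omega> \<in> U)"
    if "\<alpha> \<in> \<Gamma>" for \<alpha>
    using event_sets[OF that r] Union_event_sets[OF that] by (auto simp: pred_def U_def)
  note [measurable] = counts_comp_measurable[OF subset_refl] counts_comp_measurable[OF Diff_subset]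

  have stein: "F (counts \<Gamma> \<omega>) - E (counts \<Gamma> \<omega>) = (\<Sum>\<alpha>\<in>\<Gamma>. T \<alpha> \<omega>)" for \<omega>
  proof -
    let ?v = "counts \<Gamma> \<omega>"
    have "rate r * H ?v - real (?v r) * g ?v (?v r) = F ?v - E ?v"
      using stein_equation[OF rate, of "\<lambda>k. F (?v(r := k))" "?v r"] F
      by (simp add: H_def g_def E_def)
    moreover have "real (?v r) = (\<Sum>\<alpha>\<in>\<Gamma>. of_bool (Y \<alpha> \<omega> \<in> B r))"
      using r finite_\<Gamma> by (simp add: mark_counts_def Int_def)
    ultimately show ?thesis
      by (simp add: T_def sum_subtractf sum_distrib_right rate_def p_def)
  qed
  have T_int: "integrable M (T \<alpha>)" and T0_int: "integrable M (T0 \<alpha>)"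
    and T0_zero: "expectation (T0 \<alpha>) = 0" if \<alpha>: "\<alpha> \<in> \<Gamma>" for \<alpha>
  proof -
    have "\<bar>T \<alpha> \<omega>\<bar> \<le> 1 * c + 1 * c" for \<omega>
    proof -
      have "\<bar>p \<alpha> * H (counts \<Gamma> \<omega>)\<bar> \<le> 1 * c"
        unfolding abs_mult using p[of \<alpha>] H_bound by (intro mult_mono) auto
      moreover have "\<bar>of_bool (Y \<alpha> \<omega> \<in> B r) * g (counts \<Gamma> \<omega>) (counts \<Gamma> \<omega> r)\<bar> \<le> 1 * c"
        unfolding abs_mult using g_bound by (intro mult_mono) auto
      ultimately show ?thesis unfolding T_def by linarith
    qed
    moreover have "T \<alpha> \<in> borel_measurable M"
      unfolding T_def using ev[OF \<alpha>] by measurable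
    ultimately show "integrable M (T \<alpha>)" by (intro integrable_const_bound[where B = "1 * c + 1 * c"]) auto
    have "\<bar>of_bool (Y \<alpha> \<omega> \<in> B r) * H v\<bar> \<le> c" for \<omega> v
      using H_bound[of v] c0 by auto
    then have int1: "integrable M (\<lambda>\<omega>. of_bool (Y \<alpha> \<omega> \<in> B r) * H (counts (\<Gamma> - N \<alpha>) \<omega>))"
      using ev[OF \<alpha>] by (intro integrable_const_bound[where B = c]) auto
    have int2: "integrable M (\<lambda>\<omega>. p \<alpha> * H (counts (\<Gamma> - N \<alpha>) \<omega>))"
      using H_bound by (intro integrable_mult_right counts_comp_integrable[where c = c]) auto
    have T0: "T0 \<alpha> = (\<lambda>\<omega>. p \<alpha> * H (counts (\<Gamma> - N \<alpha>) \<omega>) - of_bool (Y \<alpha> \<omega> \<in> B r) * H (counts (\<Gamma> - N \<alpha>) \<omega>))"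
      by (simp add: T0_def algebra_simps fun_eq_iff)
    show "integrable M (T0 \<alpha>)" unfolding T0 using int1 int2 by auto
    have "bounded (range H)" using H_bound by (auto simp: bounded_iff)
    from indep_N[OF \<alpha> r this] show "expectation (T0 \<alpha>) = 0"
      unfolding T0 using int1 int2 by (simp add: p_def indicator_def of_bool_def)
  qed
  have T_bound: "\<bar>expectation (T \<alpha>)\<bar> \<le> b \<alpha>" if \<alpha>: "\<alpha> \<in> \<Gamma>" for \<alpha>
  proof -
    let ?w = "\<lambda>\<omega>. counts (\<Gamma> - N \<alpha>) \<omega>"
    define q where "q \<omega> = p \<alpha> * (\<Sum>\<beta>\<in>\<Gamma> \<inter> N \<alpha>. of_bool (Y \<beta> \<omega> \<in> U))
      + (\<Sum>\<beta>\<in>\<Gamma> \<inter> N \<alpha> - {\<alpha>}. of_bool (Y \<alpha> \<omega> \<in> B r \<and> Y \<beta> \<omega> \<in> U))" for \<omega>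
    have "has_bochner_integral M q (p \<alpha> * (\<Sum>\<beta>\<in>\<Gamma> \<inter> N \<alpha>. prob {\<omega> \<in> space M. Y \<beta> \<omega> \<in> U})
      + (\<Sum>\<beta>\<in>\<Gamma> \<inter> N \<alpha> - {\<alpha>}. prob {\<omega> \<in> space M. Y \<alpha> \<omega> \<in> B r \<and> Y \<beta> \<omega> \<in> U}))"
      unfolding q_def
    proof (intro has_bochner_integral_add has_bochner_integral_mult_right has_bochner_integral_sum
        has_bochner_integral_of_bool)
      show "{\<omega> \<in> space M. Y \<beta> \<omega> \<in> U} \<in> events" if "\<beta> \<in> \<Gamma> \<inter> N \<alpha>" for \<beta>
        using Union_event_sets[of \<beta>] that by (simp add: U_def)
      show "{\<omega> \<in> space M. Y \<alpha> \<omega> \<in> B r \<and> Y \<beta> \<omega> \<in> U} \<in> events" if "\<beta> \<in> \<Gamma> \<inter> N \<alpha> - {\<alpha>}" for \<beta>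
      proof -
        have "\<beta> \<in> \<Gamma>" using that by simp
        from ev(1)[OF \<alpha>] ev(2)[OF this] show ?thesis by measurable
      qed
    qed
    then have q_int: "integrable M q" and q_val: "2 * c * expectation q = b \<alpha>"
      by (auto simp: has_bochner_integral_iff b_def)
    have point: "\<bar>T \<alpha> \<omega> - T0 \<alpha> \<omega>\<bar> \<le> 2 * c * q \<omega>" for \<omega>
    proof -
      let ?v = "counts \<Gamma> \<omega>"
      have "T \<alpha> \<omega> - T0 \<alpha> \<omega> = p \<alpha> * (H ?v - H (?w \<omega>))
        + of_bool (Y \<alpha> \<omega> \<in> B r) * (H (?w \<omega>) - g ?v (?v r))"
        by (simp add: T_def T0_def algebra_simps)
      \<comment> \<open>Either some neighbour is marked and the sum of indicators is at least 1, or
        leaving out the neighbourhood changes no count and the difference is 0.\<close>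
      moreover have "\<bar>H ?v - H (?w \<omega>)\<bar> \<le> 2 * c * (\<Sum>\<beta>\<in>\<Gamma> \<inter> N \<alpha>. of_bool (Y \<beta> \<omega> \<in> U))"
      proof (cases "\<exists>\<beta>\<in>\<Gamma> \<inter> N \<alpha>. Y \<beta> \<omega> \<in> U")
        case True
        then obtain \<beta> where "\<beta> \<in> \<Gamma> \<inter> N \<alpha>" "Y \<beta> \<omega> \<in> U" by blast
        then have "(1::real) \<le> (\<Sum>\<beta>\<in>\<Gamma> \<inter> N \<alpha>. of_bool (Y \<beta> \<omega> \<in> U))"
          using member_le_sum[of \<beta> "\<Gamma> \<inter> N \<alpha>" "\<lambda>\<beta>. of_bool (Y \<beta> \<omega> \<in> U) :: real"] fin by simp
        then have "2 * c * 1 \<le> 2 * c * (\<Sum>\<beta>\<in>\<Gamma> \<inter> N \<alpha>. of_bool (Y \<beta> \<omega> \<in> U))"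
          using c0 by (intro mult_left_mono) auto
        then show ?thesis using H_bound[of ?v] H_bound[of "?w \<omega>"] by linarith
      next
        case False
        then have "?v = ?w \<omega>" unfolding U_def mark_counts_def
          by (intro restrict_ext arg_cong[where f = card]) auto
        then show ?thesis using c0 by (simp add: sum_nonneg)
      qed
      moreover have "\<bar>of_bool (Y \<alpha> \<omega> \<in> B r) * (H (?w \<omega>) - g ?v (?v r))\<bar>
        \<le> 2 * c * (\<Sum>\<beta>\<in>\<Gamma> \<inter> N \<alpha> - {\<alpha>}. of_bool (Y \<alpha> \<omega> \<in> B r \<and> Y \<beta> \<omega> \<in> U))"
      proof (cases "Y \<alpha> \<omega> \<in> B r")
        case True
        show ?thesis
        proof (cases "\<exists>\<beta>\<in>\<Gamma> \<inter> N \<alpha> - {\<alpha>}. Y \<beta> \<omega> \<in> U")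
          case ex: True
          then obtain \<beta> where "\<beta> \<in> \<Gamma> \<inter> N \<alpha> - {\<alpha>}" "Y \<beta> \<omega> \<in> U" by blast
          then have "(1::real) \<le> (\<Sum>\<beta>\<in>\<Gamma> \<inter> N \<alpha> - {\<alpha>}. of_bool (Y \<alpha> \<omega> \<in> B r \<and> Y \<beta> \<omega> \<in> U))"
            using True fin
              member_le_sum[of \<beta> "\<Gamma> \<inter> N \<alpha> - {\<alpha>}" "\<lambda>\<beta>. of_bool (Y \<alpha> \<omega> \<in> B r \<and> Y \<beta> \<omega> \<in> U) :: real"] by simp
          then have "2 * c * 1 \<le> 2 * c * (\<Sum>\<beta>\<in>\<Gamma> \<inter> N \<alpha> - {\<alpha>}. of_bool (Y \<alpha> \<omega> \<in> B r \<and> Y \<beta> \<omega> \<in> U))"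
            using c0 by (intro mult_left_mono) auto
          then show ?thesis using True H_bound[of "?w \<omega>"] g_bound[of ?v "?v r"] by simp
        next
          case False
          \<comment> \<open>Now \<alpha> is the only marked index of its neighbourhood, so the full
            counts are those outside it plus one in coordinate r; the shift built into H absorbs
            this.\<close>
          then have "?v = counts (insert \<alpha> (\<Gamma> - N \<alpha>)) \<omega>" unfolding U_def mark_counts_def using \<alpha>
            by (intro restrict_ext arg_cong[where f = card]) auto
          also have "\<dots> = (?w \<omega>)(r := Suc (?w \<omega> r))"
            using True r self_N[OF \<alpha>] fin by (intro counts_insert_index) auto
          finally have "g ?v (?v r) = H (?w \<omega>)" by (simp add: g_upd H_def)
          then show ?thesis using c0 by (simp add: sum_nonneg)
        qed
      qed simp
      moreover have "p \<alpha> * \<bar>H ?v - H (?w \<omega>)\<bar> \<le> p \<alpha> * (2 * c * (\<Sum>\<beta>\<in>\<Gamma> \<inter> N \<alpha>. of_bool (Y \<beta> \<omega> \<in> U)))"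
        using calculation(2) p by (intro mult_left_mono)
      moreover have "\<bar>p \<alpha> * (H ?v - H (?w \<omega>))\<bar> = p \<alpha> * \<bar>H ?v - H (?w \<omega>)\<bar>"
        using p[of \<alpha>] by (simp add: abs_mult)
      ultimately show ?thesis unfolding q_def by (simp only: distrib_left mult.left_commute[of _ "p \<alpha>"])
    qed
    have "expectation (T \<alpha>) = expectation (\<lambda>\<omega>. T \<alpha> \<omega> - T0 \<alpha> \<omega>)"
      using T_int[OF \<alpha>] T0_int[OF \<alpha>] T0_zero[OF \<alpha>] by simp
    also have "\<bar>\<dots>\<bar> \<le> expectation (\<lambda>\<omega>. \<bar>T \<alpha> \<omega> - T0 \<alpha> \<omega>\<bar>)" by (rule integral_abs_bound)
    also have "\<dots> \<le> expectation (\<lambda>\<omega>. 2 * c * q \<omega>)"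
      using T_int[OF \<alpha>] T0_int[OF \<alpha>] q_int point by (intro integral_mono) auto
    also have "\<dots> = b \<alpha>" using q_val q_int by simp
    finally show ?thesis .
  qed
  have "integrable M (\<lambda>\<omega>. F (counts \<Gamma> \<omega>))" "integrable M (\<lambda>\<omega>. E (counts \<Gamma> \<omega>))"
    using F E_bound by (auto intro!: counts_comp_integrable[where c = 1])
  then have "expectation (\<lambda>\<omega>. F (counts \<Gamma> \<omega>)) - expectation (\<lambda>\<omega>. E (counts \<Gamma> \<omega>))
    = expectation (\<lambda>\<omega>. \<Sum>\<alpha>\<in>\<Gamma>. T \<alpha> \<omega>)"
    by (simp add: stein[symmetric])
  also have "\<dots> = (\<Sum>\<alpha>\<in>\<Gamma>. expectation (T \<alpha>))" using T_int by simp
  also have "\<bar>\<dots>\<bar> \<le> (\<Sum>\<alpha>\<in>\<Gamma>. b \<alpha>)"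
    using T_bound by (intro order_trans[OF sum_abs] sum_mono)
  also have "\<dots> = dependence_error r"
    by (simp add: b_def dependence_error_def sum_distrib_left p_def U_def c_def)
  finally show ?thesis by (simp add: E_def)
qed

text \<open>Averaging out coordinate r gives a function F' that again takes values in the unit
  interval, so the induction hypothesis applies to F' and the errors add up.\<close>

lemma replace_coordinates:
  fixes F :: "('r \<Rightarrow> nat) \<Rightarrow> real"
  assumes "J \<subseteq> R" and "\<And>v. F v \<in> {0..1}"
  shows "\<bar>expectation (\<lambda>\<omega>. F (counts \<Gamma> \<omega>))
    - expectation (\<lambda>\<omega>. \<integral>z. F (\<lambda>s. if s \<in> J then z s else counts \<Gamma> \<omega> s) \<partial>PiM J (\<lambda>r. measure_pmf (Poisson (rate r))))\<bar>
    \<le> (\<Sum>r\<in>J. dependence_error r)"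
proof -
  have "finite J" using assms(1) finite_R finite_subset by blast
  then show ?thesis using assms
  proof (induction J arbitrary: F rule: finite_induct)
    case empty
    then show ?case by (simp add: PiM_empty lebesgue_integral_count_space_finite)
  next
    case (insert r J)
    interpret product_sigma_finite "\<lambda>r. measure_pmf (Poisson (rate r))" by standard
    define F' where "F' v = measure_pmf.expectation (Poisson (rate r)) (\<lambda>k. F (v(r := k)))" for v
    have F': "F' v \<in> {0..1}" for v
      unfolding F'_def by (rule expectation_in_unit_interval) (rule insert.prems)
    have "(\<integral>z. F (\<lambda>s. if s \<in> insert r J then z s else v s) \<partial>PiM (insert r J) (\<lambda>r. measure_pmf (Poisson (rate r))))
       = (\<integral>z. F' (\<lambda>s. if s \<in> J then z s else v s) \<partial>PiM J (\<lambda>r. measure_pmf (Poisson (rate r))))" for v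
    proof -
      interpret PP: prob_space "PiM (insert r J) (\<lambda>r. measure_pmf (Poisson (rate r)))"
        by (rule prob_space_PiM) (rule measure_pmf.prob_space_axioms)
      have "PiM (insert r J) (\<lambda>_. count_space (UNIV :: nat set)) = count_space (PiE (insert r J) (\<lambda>_. UNIV))"
        using insert.hyps by (intro count_space_PiM_finite) auto
      moreover have "sets (PiM (insert r J) (\<lambda>r. measure_pmf (Poisson (rate r))))
          = sets (PiM (insert r J) (\<lambda>_. count_space (UNIV :: nat set)))"
        by (intro sets_PiM_cong) auto
      ultimately have "(\<lambda>z. F (\<lambda>s. if s \<in> insert r J then z s else v s))
          \<in> borel_measurable (PiM (insert r J) (\<lambda>r. measure_pmf (Poisson (rate r))))"
        by (subst measurable_cong_sets[OF _ refl, of _ "count_space (PiE (insert r J) (\<lambda>_. UNIV))"]) simp_all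
      then have "integrable (PiM (insert r J) (\<lambda>r. measure_pmf (Poisson (rate r))))
          (\<lambda>z. F (\<lambda>s. if s \<in> insert r J then z s else v s))"
        using insert.prems by (intro PP.integrable_const_bound[where B = 1]) auto
      then have "(\<integral>z. F (\<lambda>s. if s \<in> insert r J then z s else v s) \<partial>PiM (insert r J) (\<lambda>r. measure_pmf (Poisson (rate r))))
       = (\<integral>z. (\<integral>k. F (\<lambda>s. if s \<in> insert r J then (z(r := k)) s else v s) \<partial>Poisson (rate r)) \<partial>PiM J (\<lambda>r. measure_pmf (Poisson (rate r))))"
        using insert.hyps by (intro product_integral_insert)
      also have "(\<lambda>z k. F (\<lambda>s. if s \<in> insert r J then (z(r := k)) s else v s))
         = (\<lambda>z k. F ((\<lambda>s. if s \<in> J then z s else v s)(r := k)))"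
        using insert.hyps by (intro ext arg_cong[where f = F]) auto
      finally show ?thesis by (simp add: F'_def)
    qed
    moreover have "\<bar>expectation (\<lambda>\<omega>. F (counts \<Gamma> \<omega>)) - expectation (\<lambda>\<omega>. F' (counts \<Gamma> \<omega>))\<bar> \<le> dependence_error r"
      unfolding F'_def using insert.prems by (intro replace_coordinate) auto
    moreover note insert.IH[of F', OF _ F'] insert.prems(1)
    ultimately show ?case using insert.hyps by simp
  qed
qed

theorem counts_poisson_approximation:
  assumes A: "A \<in> sets (PiM R (\<lambda>_. count_space UNIV))"
  shows "\<bar>measure (distr M (PiM R (\<lambda>_. count_space UNIV)) (counts \<Gamma>)) A
     - measure (PiM R (\<lambda>r. measure_pmf (Poisson (rate r)))) A\<bar> \<le> (\<Sum>r\<in>R. dependence_error r)"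
proof -
  let ?P = "PiM R (\<lambda>r. measure_pmf (Poisson (rate r)))"
  have sets_P: "sets ?P = sets (PiM R (\<lambda>_. count_space (UNIV :: nat set)))"
    by (intro sets_PiM_cong) auto
  interpret P: prob_space ?P
    by (rule prob_space_PiM) (rule measure_pmf.prob_space_axioms)
  have "measure (distr M (PiM R (\<lambda>_. count_space UNIV)) (counts \<Gamma>)) A
      = prob {\<omega> \<in> space M. counts \<Gamma> \<omega> \<in> A}"
    using A counts_measurable[OF subset_refl]
    by (subst measure_distr) (auto simp: vimage_def Int_def conj_commute)
  also have "\<dots> = expectation (\<lambda>\<omega>. indicator A (counts \<Gamma> \<omega>))"
    using measurable_sets[OF counts_measurable[OF subset_refl] A] has_bochner_integral_of_bool[of "\<lambda>\<omega>. counts \<Gamma> \<omega> \<in> A"]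
    by (simp add: vimage_def Int_def conj_commute indicator_def has_bochner_integral_iff)
  finally have left: "measure (distr M (PiM R (\<lambda>_. count_space UNIV)) (counts \<Gamma>)) A
    = expectation (\<lambda>\<omega>. indicator A (counts \<Gamma> \<omega>))" .
  \<comment> \<open>With all of R replaced, the integrand no longer depends on the outcome: off R
    both vectors are \<open>undefined\<close>.\<close>
  have "(\<integral>z. indicator A (\<lambda>s. if s \<in> R then z s else counts \<Gamma> \<omega> s) \<partial>?P) = (measure ?P A :: real)" for \<omega>
  proof -
    have "(\<integral>z. indicator A (\<lambda>s. if s \<in> R then z s else counts \<Gamma> \<omega> s) \<partial>?P) = (\<integral>z. indicator A z \<partial>?P :: real)"
    proof (intro Bochner_Integration.integral_cong refl arg_cong[where f = "indicator A"])
      fix z assume "z \<in> space ?P"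
      then show "(\<lambda>s. if s \<in> R then z s else counts \<Gamma> \<omega> s) = z"
        by (auto simp: space_PiM PiE_def extensional_def mark_counts_def)
    qed
    also have "\<dots> = measure ?P A" using A sets_P by simp
    finally show ?thesis .
  qed
  then show ?thesis
    using replace_coordinates[of R "indicator A"] by (simp add: left indicator_def prob_space)
qed

end

section \<open>The tail of a single entry\<close>

text \<open>The half-width t satisfies n t^2 = 1/2, so Bernoulli keeps the weight above 1/2 on an
  interval of length 2 t. The tail estimate requires the order n^(-1/2) and no sharp
  constant.\<close>

lemma entry_weight_integral_ge:
  assumes n: "2 \<le> n"
  shows "ennreal (1 / sqrt (2 * real n)) \<le> (\<integral>\<^sup>+a. ennreal (entry_weight n a) \<partial>lborel)"
proof -
  define t where "t = 1 / sqrt (2 * real n)"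
  have t: "0 < t" "t\<^sup>2 = 1 / (2 * real n)" using n by (auto simp: t_def power_divide)
  have weight_ge: "1 / 2 \<le> entry_weight n a" if a: "a \<in> {-t..t}" for a
  proof -
    have "a\<^sup>2 \<le> t\<^sup>2" using a by (intro power2_le_iff_abs_le[THEN iffD2]) auto
    then have a2: "a\<^sup>2 \<le> 1 / (2 * real n)" using t by simp
    also have "\<dots> < 1" using n by simp
    finally have a1: "a\<^sup>2 < 1" .
    have "real (n - 2) * a\<^sup>2 \<le> real n * (1 / (2 * real n))"
      using a2 by (intro mult_mono) auto
    then have "1 / 2 \<le> 1 + real (n - 2) * (- a\<^sup>2)" using n by simp
    also have "\<dots> \<le> (1 + - a\<^sup>2) ^ (n - 2)"
      using a1 by (intro Bernoulli_inequality) simp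
    also have "\<dots> \<le> sqrt (1 - a\<^sup>2) ^ (n - 2)"
    proof (intro power_mono)
      have "(1 - a\<^sup>2)\<^sup>2 \<le> 1 - a\<^sup>2"
        using a1 mult_left_le[of "1 - a\<^sup>2" "1 - a\<^sup>2"] by (simp add: power2_eq_square)
      then show "1 + - a\<^sup>2 \<le> sqrt (1 - a\<^sup>2)" using real_le_rsqrt by simp
    qed (use a1 in simp)
    finally show ?thesis using a1 by (simp add: entry_weight_def abs_square_less_1)
  qed
  have "(\<integral>\<^sup>+a. ennreal (1 / 2) * indicator {-t..t} a \<partial>lborel) \<le> (\<integral>\<^sup>+a. ennreal (entry_weight n a) \<partial>lborel)"
  proof (intro nn_integral_mono)
    fix a
    show "ennreal (1 / 2) * indicator {-t..t} a \<le> ennreal (entry_weight n a)"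
    proof (cases "a \<in> {-t..t}")
      case True
      with ennreal_leI[OF weight_ge[OF True]] show ?thesis
        by (simp only: indicator_simps mult_1_right)
    qed simp
  qed
  moreover have "(\<integral>\<^sup>+a. ennreal (1 / 2) * indicator {-t..t} a \<partial>lborel) = ennreal t"
    using t by (simp add: nn_integral_cmult ennreal_mult'[symmetric] del: ennreal_half)
  ultimately show ?thesis by (simp add: t_def)
qed

text \<open>After the Gaussian bound from 1 - x <= exp (-x), the factor a / s, at least 1 for a >=
  s, turns the majorant into an exact derivative. The two signs of a give the factor 2.\<close>

lemma entry_weight_tail_le:
  assumes n: "3 \<le> n" and s: "0 < s"
  shows "(\<integral>\<^sup>+a. ennreal (entry_weight n a) * indicator {a. s \<le> \<bar>a\<bar>} a \<partial>lborel)
     \<le> ennreal (2 * exp (- (real n - 2) * s\<^sup>2 / 2) / (s * (real n - 2)))"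
proof -
  define k where "k = real n - 2"
  have k: "0 < k" using n by (simp add: k_def)
  define f where "f a = a / s * exp (- k * a\<^sup>2 / 2)" for a
  have f_meas [measurable]: "f \<in> borel_measurable borel" unfolding f_def by measurable
  have weight_le: "entry_weight n a \<le> exp (- k * a\<^sup>2 / 2)" for a
  proof (cases "\<bar>a\<bar> < 1")
    case True
    then have "a\<^sup>2 < 1" by (simp add: abs_square_less_1)
    then have "sqrt (1 - a\<^sup>2) \<le> sqrt (exp (- a\<^sup>2))"
      using exp_ge_add_one_self[of "- a\<^sup>2"] by simp
    also have "sqrt (exp (- a\<^sup>2)) = exp (- a\<^sup>2 / 2)"
      by (intro real_sqrt_unique) (auto simp: power2_eq_square exp_add[symmetric])
    finally have "sqrt (1 - a\<^sup>2) ^ (n - 2) \<le> exp (- a\<^sup>2 / 2) ^ (n - 2)"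
      using \<open>a\<^sup>2 < 1\<close> by (intro power_mono) auto
    also have "\<dots> = exp (- k * a\<^sup>2 / 2)"
    proof -
      have "real (n - 2) = k" using n by (simp add: k_def)
      then show ?thesis unfolding exp_of_nat_mult[symmetric] by simp
    qed
    finally show ?thesis using True by (simp add: entry_weight_def)
  qed (simp add: entry_weight_def)
  have bound: "entry_weight n a \<le> f a" if "s \<le> a" for a
  proof -
    have "1 * exp (- k * a\<^sup>2 / 2) \<le> a / s * exp (- k * a\<^sup>2 / 2)"
      using that s by (intro mult_right_mono) auto
    then show ?thesis using weight_le[of a] by (simp add: f_def)
  qed
  have "((\<lambda>a. - exp (- k * a\<^sup>2 / 2) / (s * k)) \<longlongrightarrow> 0) at_top"
    using k s by real_asymp
  then have half: "(\<integral>\<^sup>+a. ennreal (f a) * indicator {s..} a \<partial>lborel) = ennreal (0 - - exp (- k * s\<^sup>2 / 2) / (s * k))"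
    using k s by (intro nn_integral_FTC_atLeast)
      (auto simp: f_def intro!: derivative_eq_intros mult_nonneg_nonneg divide_nonneg_pos)
  have "(\<integral>\<^sup>+a. ennreal (entry_weight n a) * indicator {a. s \<le> \<bar>a\<bar>} a \<partial>lborel)
    \<le> (\<integral>\<^sup>+a. ennreal (f a) * indicator {s..} a + ennreal (f (- a)) * indicator {s..} (- a) \<partial>lborel)"
  proof (intro nn_integral_mono)
    fix a
    have "entry_weight n (- a) = entry_weight n a" by (simp add: entry_weight_def)
    then show "ennreal (entry_weight n a) * indicator {a. s \<le> \<bar>a\<bar>} a
      \<le> ennreal (f a) * indicator {s..} a + ennreal (f (- a)) * indicator {s..} (- a)"
      using bound[of a] bound[of "- a"] s by (auto simp: indicator_def ennreal_leI abs_if split: if_splits)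
  qed
  also have "\<dots> = (\<integral>\<^sup>+a. ennreal (f a) * indicator {s..} a \<partial>lborel) + (\<integral>\<^sup>+a. ennreal (f (- a)) * indicator {s..} (- a) \<partial>lborel)"
    by (intro nn_integral_add) measurable
  also have "(\<integral>\<^sup>+a. ennreal (f (- a)) * indicator {s..} (- a) \<partial>lborel) = (\<integral>\<^sup>+a. ennreal (f a) * indicator {s..} a \<partial>lborel)"
    using nn_integral_real_affine[of "\<lambda>a. ennreal (f a) * indicator {s..} a" "-1" 0] by simp
  also have "(\<integral>\<^sup>+a. ennreal (f a) * indicator {s..} a \<partial>lborel) + (\<integral>\<^sup>+a. ennreal (f a) * indicator {s..} a \<partial>lborel)
     = ennreal (2 * exp (- (real n - 2) * s\<^sup>2 / 2) / (s * (real n - 2)))"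
    unfolding half using k s by (simp add: k_def ennreal_plus[symmetric] del: ennreal_plus)
  finally show ?thesis .
qed

lemma ennreal_inverse_antimono: "a \<le> b \<Longrightarrow> inverse b \<le> inverse (a :: ennreal)"
  by (simp add: less_eq_ennreal.rep_eq inverse_ennreal.rep_eq ereal_inverse_antimono enn2ereal_nonneg)

lemma entry_law_tail:
  "\<exists>K\<ge>0. \<forall>\<^sub>F n in sequentially.
     (\<integral>\<^sup>+a\<in>{a. L \<le> (real n + 1) * a\<^sup>2 - mu n}. entry_law n a \<partial>lborel) \<le> ennreal (K / (real n)\<^sup>2)"
proof -
  define s where "s n = sqrt ((mu n + L) / (real n + 1))" for n
  define T where "T n = sqrt (2 * real n) *
    (2 * exp (- (real n - 2) * ((mu n + L) / (real n + 1)) / 2) / (s n * (real n - 2)))" for n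
  \<comment> \<open>exp (- mu n / 2) equals sqrt (ln n) / n^2, and s n has order sqrt (ln n / n).
    The denominator therefore cancels both sqrt (ln n) and the prefactor sqrt (2 n), which is the
    purpose of the logarithm in \<open>mu\<close>. Replacing n - 2 by n + 1 in the exponent is
    harmless as mu grows only logarithmically.\<close>
  have "T \<in> O(\<lambda>n. 1 / (real n)\<^sup>2)"
    unfolding T_def s_def mu_def by real_asymp
  then obtain K where K: "0 < K" "\<forall>\<^sub>F n in sequentially. norm (T n) \<le> K * norm (1 / (real n)\<^sup>2)"
    by (auto elim: landau_o.bigE)
  have "\<forall>\<^sub>F n in sequentially. 0 < mu n + L"
    unfolding mu_def by real_asymp
  with K(2) eventually_ge_at_top[of 3]
  have "\<forall>\<^sub>F n in sequentially.
     (\<integral>\<^sup>+a\<in>{a. L \<le> (real n + 1) * a\<^sup>2 - mu n}. entry_law n a \<partial>lborel) \<le> ennreal (K / (real n)\<^sup>2)"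
  proof eventually_elim
    case (elim n)
    have s: "0 < s n" "(s n)\<^sup>2 = (mu n + L) / (real n + 1)" using elim by (auto simp: s_def)
    let ?H = "\<integral>\<^sup>+a. ennreal (entry_weight n a) \<partial>lborel"
    let ?num = "2 * exp (- (real n - 2) * (s n)\<^sup>2 / 2) / (s n * (real n - 2))"
    have set_eq: "L \<le> (real n + 1) * a\<^sup>2 - mu n \<longleftrightarrow> s n \<le> \<bar>a\<bar>" for a
    proof -
      have "L \<le> (real n + 1) * a\<^sup>2 - mu n \<longleftrightarrow> (s n)\<^sup>2 \<le> a\<^sup>2"
        unfolding s(2) by (subst pos_divide_le_eq) (auto simp: algebra_simps)
      also have "\<dots> \<longleftrightarrow> s n \<le> \<bar>a\<bar>" using s(1) abs_le_square_iff[of "s n" a] by simp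
      finally show ?thesis .
    qed
    have "(\<integral>\<^sup>+a\<in>{a. L \<le> (real n + 1) * a\<^sup>2 - mu n}. entry_law n a \<partial>lborel)
      = (\<integral>\<^sup>+a. ennreal (entry_weight n a) * indicator {a. s n \<le> \<bar>a\<bar>} a \<partial>lborel) / ?H"
      unfolding entry_law_def divide_ennreal_def set_eq
      by (subst nn_integral_multc[symmetric]) (auto simp: ac_simps)
    also have "\<dots> \<le> ennreal ?num / ennreal (1 / sqrt (2 * real n))"
      using elim s entry_weight_tail_le[of n "s n"] entry_weight_integral_ge[of n]
      unfolding divide_ennreal_def by (intro mult_mono ennreal_inverse_antimono) auto
    also have "\<dots> = ennreal (T n)"
    proof -
      have "0 \<le> ?num" using elim s by (intro divide_nonneg_nonneg mult_nonneg_nonneg) auto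
      moreover have "T n = sqrt (2 * real n) * ?num" by (simp only: T_def s(2))
      ultimately show ?thesis using elim by (subst divide_ennreal) (auto simp: mult.commute)
    qed
    also have "\<dots> \<le> ennreal (K / (real n)\<^sup>2)"
      using elim by (intro ennreal_leI) auto
    finally show ?case .
  qed
  then show ?thesis using K(1) by (intro exI[of _ K]) auto
qed

section \<open>Counting large correlations\<close>

lemma card_pairs: "real (card (pairs n)) = num_pairs n"
proof (induction n)
  case (Suc n)
  have "pairs (Suc n) = pairs n \<union> (\<lambda>i. (i, n)) ` {..<n}"
    by (auto simp: pairs_def less_Suc_eq)
  moreover have "pairs n \<inter> (\<lambda>i. (i, n)) ` {..<n} = {}" by (auto simp: pairs_def)
  ultimately have "card (pairs (Suc n)) = card (pairs n) + n"
    by (simp add: card_Un_disjoint finite_pairs card_image inj_on_def)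
  with Suc show ?case by (simp add: num_pairs_def field_simps)
qed (simp add: pairs_def num_pairs_def)

lemma card_pairs_le: "card (pairs n) \<le> n * n"
proof -
  have "pairs n \<subseteq> {..<n} \<times> {..<n}" by (auto simp: pairs_def)
  from card_mono[OF _ this] show ?thesis by simp
qed

context random_correlation
begin

definition scaled :: "nat \<times> nat \<Rightarrow> 'a \<Rightarrow> real" where
  "scaled p \<omega> = (real n + 1) * (X \<omega> p)\<^sup>2 - mu n"

text \<open>Built from the larger endpoint only: within \<open>pairs n\<close>, the complement is
  \<open>away n (snd \<alpha>)\<close>, and a neighbour other than \<alpha> cannot meet the smaller
  endpoint.\<close>

definition sharing_endpoint :: "nat \<times> nat \<Rightarrow> (nat \<times> nat) set" where
  "sharing_endpoint \<alpha> = {\<beta>. fst \<beta> = snd \<alpha> \<or> snd \<beta> = snd \<alpha>}"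

lemma scaled_measurable [measurable]: "p \<in> pairs n \<Longrightarrow> scaled p \<in> borel_measurable M"
  unfolding scaled_def by measurable

lemma scaled_marks:
  assumes "finite R" and B: "\<And>r. r \<in> R \<Longrightarrow> B r \<in> sets borel" and "disjoint_family_on B R"
  shows "dependent_marks M (pairs n) borel scaled R B sharing_endpoint"
proof (unfold_locales, goal_cases)
  \<comment> \<open>This is the assumption \<open>indep_N\<close>.\<close>
  case (7 \<alpha> r \<phi>)
  obtain i j where \<alpha>: "\<alpha> = (i, j)" "i < j" "j < n" using 7(1) by (auto simp: pairs_def)
  have edge: "edge j i = \<alpha>" using \<alpha> by (simp add: edge_def)
  have away: "pairs n - sharing_endpoint \<alpha> = away n j"
    by (auto simp: sharing_endpoint_def away_def \<alpha>)
  define h where "h x = (real n + 1) * x\<^sup>2 - mu n" for x :: real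
  have h [measurable]: "h \<in> borel_measurable borel" unfolding h_def by measurable
  define g where "g x = \<phi> (mark_counts R B (\<lambda>\<beta>. h (x \<beta>)) (away n j))" for x
  have g: "g \<in> borel_measurable (PiM (away n j) (\<lambda>_. lborel))"
    unfolding g_def
  proof (rule mark_counts_comp_measurable)
    fix \<beta> s assume \<beta>: "\<beta> \<in> away n j" and s: "s \<in> R"
    have [measurable]: "(\<lambda>x. x \<beta>) \<in> borel_measurable (PiM (away n j) (\<lambda>_. lborel))"
      using measurable_component_singleton[OF \<beta>, of "\<lambda>_. lborel"] by simp
    have [measurable]: "B s \<in> sets borel" using B s .
    show "Measurable.pred (PiM (away n j) (\<lambda>_. lborel)) (\<lambda>x. h (x \<beta>) \<in> B s)" by measurable
  qed (use assms finite_away in auto)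
  have g_counts: "g (restrict (X \<omega>) (away n j)) = \<phi> (mark_counts R B (\<lambda>\<beta>. scaled \<beta> \<omega>) (away n j))" for \<omega>
    unfolding g_def mark_counts_def
    by (intro arg_cong[where f = \<phi>] restrict_ext arg_cong[where f = card]) (auto simp: h_def scaled_def)
  have [measurable]: "B r \<in> sets borel" using B 7(2) .
  have ind [measurable]: "(\<lambda>x. indicator (B r) (h x) :: real) \<in> borel_measurable borel" by measurable
  \<comment> \<open>The larger index j comes first because \<open>entry_factor\<close> deletes the
    row of its first index.\<close>
  have "indep_var borel (\<lambda>\<omega>. X \<omega> \<alpha>) borel (\<lambda>\<omega>. g (restrict (X \<omega>) (away n j)))"
    using entry_factor(1)[of j i, OF _ _ _ g] \<alpha> by (simp add: edge)
  from indep_var_compose[OF this ind measurable_ident]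
  have indep: "indep_var borel (\<lambda>\<omega>. indicator (B r) (scaled \<alpha> \<omega>)) borel (\<lambda>\<omega>. g (restrict (X \<omega>) (away n j)))"
    by (simp add: comp_def h_def scaled_def)
  obtain c where c: "\<And>v. norm (\<phi> v) \<le> c" using 7(3) by (auto simp: bounded_iff)
  have meas: "random_variable borel (\<lambda>\<omega>. indicator (B r) (scaled \<alpha> \<omega>) :: real)"
    "random_variable borel (\<lambda>\<omega>. g (restrict (X \<omega>) (away n j)))"
    using indep by (auto dest: indep_var_rv1 indep_var_rv2)
  have int: "integrable M (\<lambda>\<omega>. indicator (B r) (scaled \<alpha> \<omega>) :: real)"
    by (rule integrable_const_bound[where B = 1]) (use meas in auto)
  have int': "integrable M (\<lambda>\<omega>. g (restrict (X \<omega>) (away n j)))"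
    by (rule integrable_const_bound[where B = c]) (use meas c in \<open>auto simp: g_def\<close>)
  have event: "{\<omega> \<in> space M. scaled \<alpha> \<omega> \<in> B r} \<in> events"
    using 7(1) by measurable
  have "(\<integral>\<omega>. indicator (B r) (scaled \<alpha> \<omega>) \<partial>M) = (\<integral>\<omega>. indicator {\<omega> \<in> space M. scaled \<alpha> \<omega> \<in> B r} \<omega> \<partial>M :: real)"
    by (intro Bochner_Integration.integral_cong) (auto simp: indicator_def)
  also have "\<dots> = prob {\<omega> \<in> space M. scaled \<alpha> \<omega> \<in> B r}" using event by simp
  finally show ?case
    using indep_var_lebesgue_integral[OF indep int int'] by (simp add: away g_counts)
qed (use assms finite_pairs in \<open>auto simp: sharing_endpoint_def\<close>)

lemma prob_entry:
  assumes "i < n" "k < n" "i \<noteq> k" "A \<in> sets borel"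
  shows "ennreal (prob {\<omega> \<in> space M. X \<omega> (edge i k) \<in> A}) = (\<integral>\<^sup>+a\<in>A. entry_law n a \<partial>lborel)"
  using entry_factor(2)[OF assms] by (simp add: emeasure_eq_measure)

lemma prob_scaled:
  assumes "\<alpha> \<in> pairs n" and A: "A \<in> sets borel"
  shows "ennreal (prob {\<omega> \<in> space M. scaled \<alpha> \<omega> \<in> A}) =
    (\<integral>\<^sup>+a\<in>{a. (real n + 1) * a\<^sup>2 - mu n \<in> A}. entry_law n a \<partial>lborel)"
proof -
  obtain i j where "\<alpha> = (i, j)" "i < j" "j < n" using assms(1) by (auto simp: pairs_def)
  then have \<alpha>: "\<alpha> = edge i j" "i \<noteq> j" "i < n" "j < n" by (auto simp: edge_of_less)
  have "{a. (real n + 1) * a\<^sup>2 - mu n \<in> A} \<in> sets borel" using A by measurable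
  from prob_entry[OF \<alpha>(3,4,2) this] show ?thesis by (simp add: \<alpha>(1) scaled_def)
qed

lemma prob_scaled_eq:
  assumes "\<alpha> \<in> pairs n" "\<beta> \<in> pairs n" and A: "A \<in> sets borel"
  shows "prob {\<omega> \<in> space M. scaled \<alpha> \<omega> \<in> A} = prob {\<omega> \<in> space M. scaled \<beta> \<omega> \<in> A}"
  using prob_scaled[OF assms(1) A] prob_scaled[OF assms(2) A]
  by (metis ennreal_inj measure_nonneg)

text \<open>For n < 2 the pair (0, 1) is not an index, but then the sum and
  \<open>num_pairs n\<close> are both 0.\<close>

lemma sum_prob_scaled:
  assumes A: "A \<in> sets borel"
  shows "(\<Sum>\<alpha>\<in>pairs n. prob {\<omega> \<in> space M. scaled \<alpha> \<omega> \<in> A})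
    = num_pairs n * prob {\<omega> \<in> space M. scaled (0, 1) \<omega> \<in> A}"
proof -
  have "prob {\<omega> \<in> space M. scaled \<alpha> \<omega> \<in> A} = prob {\<omega> \<in> space M. scaled (0, 1) \<omega> \<in> A}"
    if "\<alpha> \<in> pairs n" for \<alpha>
    using that by (intro prob_scaled_eq A) (auto simp: pairs_def)
  then show ?thesis by (simp add: card_pairs[symmetric])
qed

lemma expectation_card_scaled:
  assumes A: "A \<in> sets borel"
  shows "expectation (\<lambda>\<omega>. real (card {\<alpha> \<in> pairs n. scaled \<alpha> \<omega> \<in> A}))
    = num_pairs n * prob {\<omega> \<in> space M. scaled (0, 1) \<omega> \<in> A}"
proof -
  have "has_bochner_integral M (\<lambda>\<omega>. \<Sum>\<alpha>\<in>pairs n. of_bool (scaled \<alpha> \<omega> \<in> A))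
      (\<Sum>\<alpha>\<in>pairs n. prob {\<omega> \<in> space M. scaled \<alpha> \<omega> \<in> A})"
  proof (intro has_bochner_integral_sum has_bochner_integral_of_bool)
    fix \<alpha> assume "\<alpha> \<in> pairs n"
    from scaled_measurable[OF this] A show "{\<omega> \<in> space M. scaled \<alpha> \<omega> \<in> A} \<in> events" by measurable
  qed
  then show ?thesis
    unfolding sum_prob_scaled[OF A] by (simp add: has_bochner_integral_iff finite_pairs Int_def)
qed

lemma prob_scaled_tail:
  assumes "\<alpha> \<in> pairs n" "A \<in> sets borel" and L: "\<And>x. x \<in> A \<Longrightarrow> L \<le> x"
    and tail: "(\<integral>\<^sup>+a\<in>{a. L \<le> (real n + 1) * a\<^sup>2 - mu n}. entry_law n a \<partial>lborel) \<le> ennreal b" and b: "0 \<le> b"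
  shows "prob {\<omega> \<in> space M. scaled \<alpha> \<omega> \<in> A} \<le> b"
proof -
  have "ennreal (prob {\<omega> \<in> space M. scaled \<alpha> \<omega> \<in> A})
      \<le> (\<integral>\<^sup>+a\<in>{a. L \<le> (real n + 1) * a\<^sup>2 - mu n}. entry_law n a \<partial>lborel)"
    unfolding prob_scaled[OF assms(1,2)]
    using L by (intro nn_integral_mono) (auto simp: indicator_def)
  also note tail
  finally show ?thesis using b by (simp add: ennreal_le_iff)
qed

text \<open>The neighbour shares the larger endpoint and, being different from \<alpha>, misses the
  smaller one; hence the pivot is now on the smaller index.\<close>

lemma prob_scaled_pair:
  assumes \<alpha>: "\<alpha> \<in> pairs n" and \<beta>: "\<beta> \<in> pairs n \<inter> sharing_endpoint \<alpha> - {\<alpha>}"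
    and A [measurable]: "A \<in> sets borel" "A' \<in> sets borel"
  shows "prob {\<omega> \<in> space M. scaled \<alpha> \<omega> \<in> A \<and> scaled \<beta> \<omega> \<in> A'} =
    prob {\<omega> \<in> space M. scaled \<alpha> \<omega> \<in> A} * prob {\<omega> \<in> space M. scaled \<beta> \<omega> \<in> A'}"
proof -
  obtain i j where ij: "\<alpha> = (i, j)" "i < j" "j < n" using \<alpha> by (auto simp: pairs_def)
  have edge: "edge i j = \<alpha>" using ij by (simp add: edge_def)
  have \<beta>_away: "\<beta> \<in> away n i"
    using \<beta> ij by (auto simp: away_def sharing_endpoint_def pairs_def)
  have "(\<lambda>x. x \<beta>) \<in> borel_measurable (PiM (away n i) (\<lambda>_. lborel))"
    using measurable_component_singleton[OF \<beta>_away, of "\<lambda>_. lborel"] by simp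
  then have "indep_var borel (\<lambda>\<omega>. X \<omega> \<alpha>) borel (\<lambda>\<omega>. X \<omega> \<beta>)"
    using entry_factor(1)[of i j "\<lambda>x. x \<beta>"] ij \<beta>_away by (simp add: edge)
  moreover have "(\<lambda>x. (real n + 1) * x\<^sup>2 - mu n) \<in> borel_measurable borel" by measurable
  ultimately have "indep_var borel (scaled \<alpha>) borel (scaled \<beta>)"
    using indep_var_compose[of borel "\<lambda>\<omega>. X \<omega> \<alpha>" borel "\<lambda>\<omega>. X \<omega> \<beta>"
        "\<lambda>x. (real n + 1) * x\<^sup>2 - mu n" borel "\<lambda>x. (real n + 1) * x\<^sup>2 - mu n" borel]
    by (simp add: comp_def scaled_def[abs_def])
  from indep_varD[OF this A] show ?thesis
    by (simp add: vimage_def Int_def conj_commute)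
qed

text \<open>The rates are at most n^2 * K / n^2 = K. Each of the two Chen-Stein sums has at most n^2
  * n terms of size at most (K / n^2)^2; together with the factor 2 exp K this gives the constant
  4.\<close>

lemma poisson_approximation:
  assumes "finite R" and B: "\<And>r. r \<in> R \<Longrightarrow> B r \<in> sets borel" and "disjoint_family_on B R"
    and K: "0 \<le> K" "prob {\<omega> \<in> space M. scaled (0, 1) \<omega> \<in> (\<Union>r\<in>R. B r)} \<le> K / (real n)\<^sup>2"
    and A: "A \<in> sets (PiM R (\<lambda>_. count_space UNIV))"
  shows "\<bar>measure (distr M (PiM R (\<lambda>_. count_space UNIV)) (\<lambda>\<omega>. mark_counts R B (\<lambda>\<alpha>. scaled \<alpha> \<omega>) (pairs n))) A
     - measure (PiM R (\<lambda>r. measure_pmf (Poisson (num_pairs n * prob {\<omega> \<in> space M. scaled (0, 1) \<omega> \<in> B r})))) A\<bar>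
    \<le> real (card R) * (4 * exp K * K\<^sup>2) / real n"
proof -
  interpret D: dependent_marks M "pairs n" borel scaled R B sharing_endpoint
    by (rule scaled_marks) fact+
  let ?U = "\<Union>r\<in>R. B r"
  let ?k = "K / (real n)\<^sup>2"
  have k0: "0 \<le> ?k" using K by simp
  have U: "?U \<in> sets borel" using assms(1) B by (intro sets.finite_UN) auto
  have rate: "D.rate r = num_pairs n * prob {\<omega> \<in> space M. scaled (0, 1) \<omega> \<in> B r}" if "r \<in> R" for r
    unfolding D.rate_def by (rule sum_prob_scaled[OF B[OF that]])
  have PU: "prob {\<omega> \<in> space M. scaled \<alpha> \<omega> \<in> ?U} \<le> ?k" if "\<alpha> \<in> pairs n" for \<alpha>
  proof -
    have "(0, 1) \<in> pairs n" using that by (auto simp: pairs_def)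
    then show ?thesis using K(2) prob_scaled_eq[OF that _ U] by simp
  qed
  have PB: "prob {\<omega> \<in> space M. scaled \<alpha> \<omega> \<in> B r} \<le> ?k" if "\<alpha> \<in> pairs n" "r \<in> R" for \<alpha> r
    using that by (intro order_trans[OF finite_measure_mono PU] D.Union_event_sets) auto
  have "D.dependence_error r \<le> 4 * exp K * K\<^sup>2 / real n" if r: "r \<in> R" for r
  proof (cases "n = 0")
    case True
    then have "pairs n = {}" by (simp add: pairs_def)
    then have "D.dependence_error r = 0" unfolding D.dependence_error_def by simp
    also have "0 \<le> 4 * exp K * K\<^sup>2 / real n" by simp
    finally show ?thesis .
  next
    case False
    have card_N: "card (pairs n \<inter> sharing_endpoint \<alpha>) \<le> n" for \<alpha>
    proof -
      have "\<beta> \<in> edge (snd \<alpha>) ` {..<n}" if "\<beta> \<in> pairs n \<inter> sharing_endpoint \<alpha>" for \<beta>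
      proof (rule image_eqI)
        show "\<beta> = edge (snd \<alpha>) (if fst \<beta> = snd \<alpha> then snd \<beta> else fst \<beta>)"
          using that by (auto simp: pairs_def sharing_endpoint_def edge_def)
        show "(if fst \<beta> = snd \<alpha> then snd \<beta> else fst \<beta>) \<in> {..<n}"
          using that by (auto simp: pairs_def)
      qed
      then have "card (pairs n \<inter> sharing_endpoint \<alpha>) \<le> card (edge (snd \<alpha>) ` {..<n})"
        by (intro card_mono) auto
      also have "\<dots> \<le> n" using card_image_le[of "{..<n}" "edge (snd \<alpha>)"] by simp
      finally show ?thesis .
    qed
    have "D.rate r \<le> (\<Sum>\<alpha>\<in>pairs n. ?k)"
      unfolding D.rate_def using PB r by (intro sum_mono) auto
    also have "\<dots> \<le> real (n * n) * ?k"
      using card_pairs_le[of n] k0 by (simp only: sum_constant) (intro mult_right_mono of_nat_mono)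
    also have "\<dots> = K" using False by (simp add: power2_eq_square)
    finally have rate_le: "exp (D.rate r) \<le> exp K" by simp
    let ?b = "\<lambda>\<alpha>. prob {\<omega> \<in> space M. scaled \<alpha> \<omega> \<in> B r} *
        (\<Sum>\<beta>\<in>pairs n \<inter> sharing_endpoint \<alpha>. prob {\<omega> \<in> space M. scaled \<beta> \<omega> \<in> ?U})
      + (\<Sum>\<beta>\<in>pairs n \<inter> sharing_endpoint \<alpha> - {\<alpha>}. prob {\<omega> \<in> space M. scaled \<alpha> \<omega> \<in> B r \<and> scaled \<beta> \<omega> \<in> ?U})"
    have b: "?b \<alpha> \<le> 2 * (real n * (?k * ?k))" if \<alpha>: "\<alpha> \<in> pairs n" for \<alpha>
    proof -
      have "(\<Sum>\<beta>\<in>pairs n \<inter> sharing_endpoint \<alpha>. prob {\<omega> \<in> space M. scaled \<beta> \<omega> \<in> ?U})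
          \<le> real (card (pairs n \<inter> sharing_endpoint \<alpha>)) * ?k"
        using PU by (intro sum_bounded_above) auto
      also have "\<dots> \<le> real n * ?k"
        using card_N k0 by (intro mult_right_mono of_nat_mono) auto
      finally have "prob {\<omega> \<in> space M. scaled \<alpha> \<omega> \<in> B r} *
        (\<Sum>\<beta>\<in>pairs n \<inter> sharing_endpoint \<alpha>. prob {\<omega> \<in> space M. scaled \<beta> \<omega> \<in> ?U}) \<le> ?k * (real n * ?k)"
        using PB[OF \<alpha> r] k0 by (intro mult_mono sum_nonneg) auto
      moreover have "(\<Sum>\<beta>\<in>pairs n \<inter> sharing_endpoint \<alpha> - {\<alpha>}. prob {\<omega> \<in> space M. scaled \<alpha> \<omega> \<in> B r \<and> scaled \<beta> \<omega> \<in> ?U})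
          \<le> real (card (pairs n \<inter> sharing_endpoint \<alpha> - {\<alpha>})) * (?k * ?k)"
      proof (rule sum_bounded_above)
        fix \<beta> assume \<beta>: "\<beta> \<in> pairs n \<inter> sharing_endpoint \<alpha> - {\<alpha>}"
        show "prob {\<omega> \<in> space M. scaled \<alpha> \<omega> \<in> B r \<and> scaled \<beta> \<omega> \<in> ?U} \<le> ?k * ?k"
          unfolding prob_scaled_pair[OF \<alpha> \<beta> B[OF r] U]
          using PB[OF \<alpha> r] PU[of \<beta>] \<beta> k0 by (intro mult_mono) auto
      qed
      moreover have "real (card (pairs n \<inter> sharing_endpoint \<alpha> - {\<alpha>})) * (?k * ?k) \<le> real n * (?k * ?k)"
      proof (intro mult_right_mono of_nat_mono)
        have "card (pairs n \<inter> sharing_endpoint \<alpha> - {\<alpha>}) \<le> card (pairs n \<inter> sharing_endpoint \<alpha>)"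
          by (intro card_mono) (auto simp: finite_pairs)
        then show "card (pairs n \<inter> sharing_endpoint \<alpha> - {\<alpha>}) \<le> n" using card_N[of \<alpha>] by simp
      qed (use k0 in simp)
      moreover have "?k * (real n * ?k) = real n * (?k * ?k)" by (simp only: mult.left_commute)
      ultimately show ?thesis by linarith
    qed
    have "(\<Sum>\<alpha>\<in>pairs n. ?b \<alpha>) \<le> real (card (pairs n)) * (2 * (real n * (?k * ?k)))"
      using b by (intro sum_bounded_above) auto
    also have "\<dots> \<le> real (n * n) * (2 * (real n * (?k * ?k)))"
      using card_pairs_le[of n] by (intro mult_right_mono of_nat_mono) auto
    also have "\<dots> = 2 * K\<^sup>2 / real n" using False by (simp add: field_simps power2_eq_square)
    finally have sum_b: "(\<Sum>\<alpha>\<in>pairs n. ?b \<alpha>) \<le> 2 * K\<^sup>2 / real n" .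
    have "D.dependence_error r \<le> 2 * exp K * (2 * K\<^sup>2 / real n)"
      unfolding D.dependence_error_def using rate_le sum_b
      by (intro mult_mono mult_left_mono sum_nonneg add_nonneg_nonneg mult_nonneg_nonneg) auto
    then show ?thesis by simp
  qed
  then have "(\<Sum>r\<in>R. D.dependence_error r) \<le> real (card R) * (4 * exp K * K\<^sup>2 / real n)"
    by (intro sum_bounded_above)
  moreover have "PiM R (\<lambda>r. measure_pmf (Poisson (D.rate r))) =
      PiM R (\<lambda>r. measure_pmf (Poisson (num_pairs n * prob {\<omega> \<in> space M. scaled (0, 1) \<omega> \<in> B r})))"
    by (intro PiM_cong) (simp_all add: rate)
  ultimately show ?thesis
    using D.counts_poisson_approximation[OF A] by simp
qed

end

section \<open>Return to random matrices and the asymptotic statement\<close>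

lemma uniform_correlation_imp_random_correlation:
  assumes "uniform_correlation M n C"
  shows "random_correlation M n (\<lambda>\<omega>. offdiag n (C \<omega>))"
  using assms unfolding uniform_correlation_def random_correlation_def random_correlation_axioms_def
  by (simp add: offdiag_image_correlation_matrices)

theorem mainTheorem4:
  fixes M :: "nat \<Rightarrow> 'a measure"
    and C :: "nat \<Rightarrow> 'a \<Rightarrow> real mat"
    and m :: nat
    and B :: "nat \<Rightarrow> real set"
  assumes "\<And>n. n \<ge> 1 \<Longrightarrow> uniform_correlation (M n) n (C n)"
    and "disjoint_family_on B {1..m}"
    and "\<And>r. r \<in> {1..m} \<Longrightarrow> B r \<in> sets borel"
    and "\<And>r. r \<in> {1..m} \<Longrightarrow> bdd_below (B r)"
    and "\<And>r. r \<in> {1..m} \<Longrightarrow> emeasure Lambda (B r) < \<infinity>"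
    and "\<And>r. r \<in> {1..m} \<Longrightarrow> emeasure Lambda (frontier (B r)) = 0"
  shows "(\<lambda>n. tv_dist (Xi_law (M n) n (C n) m B)
                (Poisson_product m (\<lambda>r. num_pairs n * pair_prob (M n) n (C n) (B r))))
           \<in> O(\<lambda>n. 1 / real n)
       \<and> (\<forall>n\<ge>1. \<forall>r\<in>{1..m}.
            num_pairs n * pair_prob (M n) n (C n) (B r)
              = (\<integral>\<omega>. real (Xi n (C n \<omega>) (B r)) \<partial>M n))"
proof (intro conjI allI impI ballI)
  define X where "X n \<omega> = offdiag n (C n \<omega>)" for n \<omega>
  have rc: "random_correlation (M n) n (X n)" if "1 \<le> n" for n
    unfolding X_def[abs_def] by (rule uniform_correlation_imp_random_correlation[OF assms(1)[OF that]])
  have scaled: "random_correlation.scaled n (X n) p \<omega> = (real n + 1) * (C n \<omega> $$ p)\<^sup>2 - mu n"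
    if "1 \<le> n" "p \<in> pairs n" for n p \<omega>
    using that by (simp add: random_correlation.scaled_def[OF rc] X_def offdiag_def)
  have Xi: "Xi n (C n \<omega>) A = card {\<alpha> \<in> pairs n. random_correlation.scaled n (X n) \<alpha> \<omega> \<in> A}"
    if "1 \<le> n" for n \<omega> A
    unfolding Xi_def using scaled[OF that] by (intro arg_cong[where f = card]) auto
  have mean: "num_pairs n * pair_prob (M n) n (C n) A =
      num_pairs n * measure (M n) {\<omega> \<in> space (M n). random_correlation.scaled n (X n) (0, 1) \<omega> \<in> A}"
    if n: "1 \<le> n" for n A
  \<comment> \<open>For n = 1 the position (0, 1) lies outside the matrix and the two probabilities
    need not agree; both are multiplied by \<open>num_pairs 1\<close>, which is 0.\<close>
  proof (cases "n = 1")
    case False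
    then have "(0, 1) \<in> pairs n" using n by (auto simp: pairs_def)
    then show ?thesis by (simp add: pair_prob_def scaled[OF n])
  qed (simp add: num_pairs_def)

  show "num_pairs n * pair_prob (M n) n (C n) (B r) = (\<integral>\<omega>. real (Xi n (C n \<omega>) (B r)) \<partial>M n)"
    if "1 \<le> n" "r \<in> {1..m}" for n r
    using random_correlation.expectation_card_scaled[OF rc[OF that(1)] assms(3)[OF that(2)]]
    by (simp add: Xi[OF that(1)] mean[OF that(1)])

  let ?U = "\<Union>r\<in>{1..m}. B r"
  \<comment> \<open>One lower bound for the finitely many sets, so that a single tail constant K
    serves every r.\<close>
  have "bdd_below ?U" using assms(4) by simp
  then obtain L where L: "\<And>x. x \<in> ?U \<Longrightarrow> L \<le> x" by (auto simp: bdd_below_def)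
  obtain K where K: "0 \<le> K" and tail: "\<forall>\<^sub>F n in sequentially.
      (\<integral>\<^sup>+a\<in>{a. L \<le> (real n + 1) * a\<^sup>2 - mu n}. entry_law n a \<partial>lborel) \<le> ennreal (K / (real n)\<^sup>2)"
    using entry_law_tail[of L] by blast
  define c where "c = real m * (4 * exp K * K\<^sup>2)"
  show "(\<lambda>n. tv_dist (Xi_law (M n) n (C n) m B)
        (Poisson_product m (\<lambda>r. num_pairs n * pair_prob (M n) n (C n) (B r)))) \<in> O(\<lambda>n. 1 / real n)"
  proof (rule bigoI[where c = c])
    show "\<forall>\<^sub>F n in sequentially. norm (tv_dist (Xi_law (M n) n (C n) m B)
        (Poisson_product m (\<lambda>r. num_pairs n * pair_prob (M n) n (C n) (B r)))) \<le> c * norm (1 / real n)"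
      using tail eventually_ge_at_top[of 2]
    proof eventually_elim
      case (elim n)
      then have n: "1 \<le> n" and pair: "(0, 1) \<in> pairs n" by (auto simp: pairs_def)
      interpret random_correlation "M n" n "X n" by (rule rc[OF n])
      let ?P = "Xi_law (M n) n (C n) m B"
      let ?Q = "Poisson_product m (\<lambda>r. num_pairs n * pair_prob (M n) n (C n) (B r))"
      have U: "?U \<in> sets borel" using assms(3) by (intro sets.finite_UN) auto
      have small: "prob {\<omega> \<in> space (M n). scaled (0, 1) \<omega> \<in> ?U} \<le> K / (real n)\<^sup>2"
        using K by (intro prob_scaled_tail[OF pair U L elim(1)]) auto
      have P: "?P = distr (M n) (PiM {1..m} (\<lambda>_. count_space UNIV))
          (\<lambda>\<omega>. mark_counts {1..m} B (\<lambda>\<alpha>. scaled \<alpha> \<omega>) (pairs n))"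
        unfolding Xi_law_def mark_counts_def Xi[OF n] ..
      have Q: "?Q = PiM {1..m} (\<lambda>r. measure_pmf (Poisson (num_pairs n * prob {\<omega> \<in> space (M n). scaled (0, 1) \<omega> \<in> B r})))"
        unfolding Poisson_product_def mean[OF n] ..
      have bound: "\<bar>measure ?P A - measure ?Q A\<bar> \<le> c / real n" if "A \<in> sets ?P" for A
        using poisson_approximation[OF _ assms(3) assms(2) K small, of A] that
        unfolding P Q by (simp add: c_def)
      have "tv_dist ?P ?Q \<le> c / real n"
        unfolding tv_dist_def using bound by (intro cSUP_least) auto
      \<comment> \<open>The norm in the asymptotic bound calls for a sign: the empty event
        contributes 0 to a supremum that \<open>bound\<close> shows to be finite.\<close>
      moreover have "0 \<le> tv_dist ?P ?Q"
        unfolding tv_dist_def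
      proof (rule cSUP_upper2[of _ _ "{}"])
        show "bdd_above ((\<lambda>A. \<bar>measure ?P A - measure ?Q A\<bar>) ` sets ?P)"
          using bound by (intro bdd_aboveI2)
      qed auto
      ultimately show ?case by simp
    qed
  qed
qed

end
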